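(* Let $V$ be a C$^*$-ordered operator space and let $m,n\in\mathbb{N}$. Let $f\in Q_{m+n}(V)$, $f=\begin{bmatrix} f_{11}& f_{12}\\ f_{12}^*& f_{22}\end{bmatrix}$ with $f_{11}\in M_m(V^* )^+$, $f_{22}\in M_n(V^* )^+$ and $f_{12}\in M_{m,n}(V^* )$. Then: (1) $f_{11}\in Q_m(V)$ and $f_{22}\in Q_n(V)$; (2) $\begin{bmatrix} f_{11}& e^{i\theta}f_{12}\\ e^{-i\theta}f_{12}^*& f_{22}\end{bmatrix}\in Q_{m+n}(V)$ for every $\theta\in\mathbb{R}$; (3) $\left\|\begin{bmatrix}0&f_{12}\\ f_{12}^*&0\end{bmatrix}\right\|_{m+n}\le\left\|\begin{bmatrix}f_{11}&f_{12}\\ f_{12}^*&f_{22}\end{bmatrix}\right\|_{m+n}$ and $\left\|\begin{bmatrix}f_{11}&0\\ 0&f_{22}\end{bmatrix}\right\|_{m+n}\le\left\|\begin{bmatrix}f_{11}&f_{12}\\ f_{12}^*&f_{22}\end{bmatrix}\right\|_{m+n}$; (4) if $m=n$, then $f_{12}+f_{12}^*\in\operatorname{co}(Q_n(V)\cup(-Q_n(V)))$; (5) if $g\in Q_n(V)$ and $\gamma_i$ ($1\le i\le k$) are complex $n\times n_i$ matrices with $\sum_{i=1}^k\gamma_i\gamma_i^*\le I_n$, then $\bigoplus_{i=1}^k\gamma_i^*g\gamma_i\in Q_{\sum_{i=1}^k n_i}(V)$; (6) if $f_{11}=\alpha_1\widehat{f_{11}}$ and $f_{22}=\alpha_2\widehat{f_{22}}$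 with $\alpha_1,\alpha_2\in[0,1]$, $\widehat{f_{11}}\in S_m(V)$ and $\widehat{f_{22}}\in S_n(V)$, then $\alpha_1+\alpha_2\le1$.
   Context: For a complex $*$-vector space $V$, $V_{sa}$ is the set of self-adjoint elements, and $M_n(V)$ is a $*$-vector space with $[v_{ij}]^*=[v_{ji}^*]$. A cone is a subset of the self-adjoint part closed under addition and under multiplication by nonnegative reals. $V$ is matrix ordered if each $M_n(V)_{sa}$ carries a cone $M_n(V)^+$ with $\gamma^*M_m(V)^+\gamma\subseteq M_n(V)^+$ for all scalar $m\times n$ matrices $\gamma$; $u\le v$ means $v-u\in M_n(V)^+$. $V^+=M_1(V)^+$ is proper if $V^+\cap(-V^+)=\{0\}$. An abstract operator space is a complex vector space $V$ with norms $\|\cdot\|_n$ on $M_n(V)$ such that $\|v\oplus w\|_{n+m}=\max\{\|v\|_n,\|w\|_m\}$ and $\|\alpha v\beta\|_n\le\|\alpha\|\,\|v\|_n\|\beta\|$ for scalar matrices $\alpha,\beta$. A C$^*$-ordered operator space is a matrix ordered $*$-vector space $V$ with matrix norms making it an abstract operator space, such that $V^+$ is proper and for each $n$: (1) $*$ is an isometry on $M_n(V)$; (2) $M_n(V)^+$ is norm closed; (3) $\|g\|_n\le\max\{\|f\|_n,\|h\|_n\}$ whenever $f\le g\le h$ in $M_n(V)_{sa}$. $V^*$ is the Banach dual of $V$, with $f^*(v)=\overline{f(v^* )}$. $M_n(V^* )$ is identified with the dual of $M_n(V)$ by the pairing $[f_{ij}]([v_{ij}])=\sum_{i,j}f_{ij}(v_{ij})$,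 carries the dual norm $\|\cdot\|_n$ and the cone $M_n(V^* )^+=\{f\in M_n(V^* )_{sa}: f(v)\ge0\ \forall v\in M_n(V)^+\}$. Put $Q_n(V)=\{f\in M_n(V^* )^+:\|f\|_n\le1\}$ and $S_n(V)=\{f\in Q_n(V):\|f\|_n=1\}$. $\operatorname{co}$ denotes convex hull. *)

theory Defs
  imports
    "HOL-Analysis.L2_Norm"
    "HOL-Analysis.Abstract_Metric_Spaces"
    "HOL-Library.Function_Algebras"
    "Jordan_Normal_Form.Schur_Decomposition"
begin

text \<open>
  \<open>M\<^sub>n(V)\<close> is \<^term>\<open>carrier_mat n n\<close> over the type of vectors. The complex vector space structure
  of \<open>V\<close> is given by an explicit scalar multiplication on a type of class \<^class>\<open>ab_group_add\<close>.
  Functionals are elements of \<open>'v \<Rightarrow> complex\<close> with the pointwise operations, so that matrices of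
  functionals are handled by the same matrix operations. Matrix sizes are at least 1 throughout.
\<close>

subsection \<open>Scalar matrices\<close>

definition cvec_norm :: "complex vec \<Rightarrow> real" where
  "cvec_norm x = L2_set (\<lambda>i. cmod (x $ i)) {..<dim_vec x}"

definition op_norm :: "complex mat \<Rightarrow> real" where
  "op_norm \<alpha> = (SUP x\<in>{x \<in> carrier_vec (dim_col \<alpha>). cvec_norm x \<le> 1}. cvec_norm (\<alpha> *\<^sub>v x))"

text \<open>The order on \<^typ>\<open>complex\<close> is that of \<^theory>\<open>HOL-Library.Complex_Order\<close>: \<open>0 \<le> z\<close> says that
  \<open>z\<close> is real and nonnegative.\<close>

definition mat_le :: "nat \<Rightarrow> complex mat \<Rightarrow> complex mat \<Rightarrow> bool" where
  "mat_le n \<alpha> \<beta> \<longleftrightarrow> \<alpha> \<in> carrier_mat n n \<and> \<beta> \<in> carrier_mat n n \<and>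
     (\<forall>x \<in> carrier_vec n. 0 \<le> ((\<beta> - \<alpha>) *\<^sub>v x) \<bullet>c x)"

subsection \<open>Matrices over a complex star-vector space\<close>

definition mat_star :: "('a \<Rightarrow> 'a) \<Rightarrow> 'a mat \<Rightarrow> 'a mat" where
  "mat_star st v = mat (dim_col v) (dim_row v) (\<lambda>(i,j). st (v $$ (j,i)))"

text \<open>The product \<open>\<alpha> v \<beta>\<close> with scalar matrices \<open>\<alpha>\<close>, \<open>\<beta>\<close>, where \<open>sc\<close> is scalar multiplication.\<close>

definition bimod_mult ::
    "(complex \<Rightarrow> 'a \<Rightarrow> 'a::comm_monoid_add) \<Rightarrow> complex mat \<Rightarrow> 'a mat \<Rightarrow> complex mat \<Rightarrow> 'a mat" where
  "bimod_mult sc \<alpha> v \<beta> = mat (dim_row \<alpha>) (dim_col \<beta>)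
     (\<lambda>(i,j). \<Sum>k<dim_row v. \<Sum>l<dim_col v. sc (\<alpha> $$ (i,k) * \<beta> $$ (l,j)) (v $$ (k,l)))"

definition mat_direct_sum :: "'a::zero mat \<Rightarrow> 'a mat \<Rightarrow> 'a mat" where
  "mat_direct_sum v w = four_block_mat v (0\<^sub>m (dim_row v) (dim_col w)) (0\<^sub>m (dim_row w) (dim_col v)) w"

text \<open>Only the values \<open>pos V n\<close> and \<open>mnorm V n v\<close> with \<open>n \<ge> 1\<close> and \<open>v \<in> M\<^sub>n(V)\<close> are relevant.\<close>

record 'v matrix_space =
  scl :: "complex \<Rightarrow> 'v \<Rightarrow> 'v"
  star :: "'v \<Rightarrow> 'v"
  pos :: "nat \<Rightarrow> 'v mat set"
  mnorm :: "nat \<Rightarrow> 'v mat \<Rightarrow> real"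

definition mat_sa :: "('a \<Rightarrow> 'a) \<Rightarrow> nat \<Rightarrow> 'a mat set" where
  "mat_sa st n = {v \<in> carrier_mat n n. mat_star st v = v}"

locale star_vector_space =
  fixes V :: "'v::ab_group_add matrix_space"
  assumes vector_space: "vector_space (scl V)"
    and star_add: "star V (u + v) = star V u + star V v"
    and star_scl: "star V (scl V c v) = scl V (cnj c) (star V v)"
    and star_star: "star V (star V v) = v"

locale matrix_ordered_space = star_vector_space +
  assumes pos_sa: "1 \<le> n \<Longrightarrow> pos V n \<subseteq> mat_sa (star V) n"
    and pos_add: "\<lbrakk>1 \<le> n; u \<in> pos V n; v \<in> pos V n\<rbrakk> \<Longrightarrow> u + v \<in> pos V n"
    and pos_scl: "\<lbrakk>1 \<le> n; u \<in> pos V n; 0 \<le> (r::real)\<rbrakk>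
                  \<Longrightarrow> map_mat (scl V (complex_of_real r)) u \<in> pos V n"
    and pos_compress: "\<lbrakk>1 \<le> m; 1 \<le> n; \<gamma> \<in> carrier_mat m n; v \<in> pos V m\<rbrakk>
                  \<Longrightarrow> bimod_mult (scl V) (mat_adjoint \<gamma>) v \<gamma> \<in> pos V n"

locale abstract_operator_space =
  fixes V :: "'v::ab_group_add matrix_space"
  assumes vector_space: "vector_space (scl V)"
    and mnorm_nonneg: "\<lbrakk>1 \<le> n; v \<in> carrier_mat n n\<rbrakk> \<Longrightarrow> 0 \<le> mnorm V n v"
    and mnorm_eq_0: "\<lbrakk>1 \<le> n; v \<in> carrier_mat n n\<rbrakk> \<Longrightarrow> mnorm V n v = 0 \<longleftrightarrow> v = 0\<^sub>m n n"
    and mnorm_triangle: "\<lbrakk>1 \<le> n; u \<in> carrier_mat n n; v \<in> carrier_mat n n\<rbrakk>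
                  \<Longrightarrow> mnorm V n (u + v) \<le> mnorm V n u + mnorm V n v"
    and mnorm_scl: "\<lbrakk>1 \<le> n; v \<in> carrier_mat n n\<rbrakk>
                  \<Longrightarrow> mnorm V n (map_mat (scl V c) v) = cmod c * mnorm V n v"
    and mnorm_direct_sum: "\<lbrakk>1 \<le> n; 1 \<le> m; v \<in> carrier_mat n n; w \<in> carrier_mat m m\<rbrakk>
                  \<Longrightarrow> mnorm V (n + m) (mat_direct_sum v w) = max (mnorm V n v) (mnorm V m w)"
    and mnorm_bimod: "\<lbrakk>1 \<le> n; \<alpha> \<in> carrier_mat n n; v \<in> carrier_mat n n; \<beta> \<in> carrier_mat n n\<rbrakk>
                  \<Longrightarrow> mnorm V n (bimod_mult (scl V) \<alpha> v \<beta>) \<le> op_norm \<alpha> * mnorm V n v * op_norm \<beta>"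

text \<open>\<^locale>\<open>Metric_space\<close> requires symmetry and nonnegativity of the distance also outside the
  carrier, where the norm is arbitrary; hence the case distinction.\<close>

definition mat_dist :: "'v::ab_group_add matrix_space \<Rightarrow> nat \<Rightarrow> 'v mat \<Rightarrow> 'v mat \<Rightarrow> real" where
  "mat_dist V n u v = (if u \<in> carrier_mat n n \<and> v \<in> carrier_mat n n then mnorm V n (u - v) else 0)"

lemma (in abstract_operator_space) Metric_space_mat_dist:
  assumes n: "1 \<le> n"
  shows "Metric_space (carrier_mat n n) (mat_dist V n)"
proof
  interpret vector_space "scl V" by (rule vector_space)
  show "0 \<le> mat_dist V n u v" for u v
    using mnorm_nonneg[OF n, of "u - v"] by (auto simp: mat_dist_def minus_carrier_mat)
  show "mat_dist V n u v = mat_dist V n v u" for u v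
  proof (cases "u \<in> carrier_mat n n \<and> v \<in> carrier_mat n n")
    case True
    have "map_mat (scl V (-1)) (u - v) = v - u"
      by (rule eq_matI) (use True in auto)
    then show ?thesis
      using mnorm_scl[OF n, of "u - v" "-1"] True by (simp add: mat_dist_def minus_carrier_mat)
  qed (auto simp: mat_dist_def)
  show "mat_dist V n u v = 0 \<longleftrightarrow> u = v" if "u \<in> carrier_mat n n" "v \<in> carrier_mat n n" for u v
  proof -
    have "u - v = 0\<^sub>m n n \<longleftrightarrow> u = v"
    proof
      assume a: "u - v = 0\<^sub>m n n"
      show "u = v"
      proof (rule eq_matI)
        fix i j assume ij: "i < dim_row v" "j < dim_col v"
        from a have "(u - v) $$ (i,j) = 0\<^sub>m n n $$ (i,j)" by simp
        with ij that show "u $$ (i,j) = v $$ (i,j)" by auto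
      qed (use that in auto)
    qed (use that in auto)
    then show ?thesis
      using that mnorm_eq_0[OF n, of "u - v"] by (simp add: mat_dist_def minus_carrier_mat)
  qed
  show "mat_dist V n u w \<le> mat_dist V n u v + mat_dist V n v w"
    if "u \<in> carrier_mat n n" "v \<in> carrier_mat n n" "w \<in> carrier_mat n n" for u v w
  proof -
    have "u - w = (u - v) + (v - w)"
      by (rule eq_matI) (use that in auto)
    then show ?thesis
      using that mnorm_triangle[OF n, of "u - v" "v - w"] by (simp add: mat_dist_def minus_carrier_mat)
  qed
qed

locale cstar_ordered_operator_space = matrix_ordered_space V + abstract_operator_space V
  for V :: "'v::ab_group_add matrix_space" +
  assumes pos_proper: "pos V 1 \<inter> uminus ` pos V 1 = {0\<^sub>m 1 1}"
    and mnorm_star: "\<lbrakk>1 \<le> n; v \<in> carrier_mat n n\<rbrakk> \<Longrightarrow> mnorm V n (mat_star (star V) v) = mnorm V n v"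
    and pos_closed: "1 \<le> n \<Longrightarrow>
          closedin (Metric_space.mtopology (carrier_mat n n) (mat_dist V n)) (pos V n)"
    and mnorm_order: "\<lbrakk>1 \<le> n; f \<in> mat_sa (star V) n; g \<in> mat_sa (star V) n; h \<in> mat_sa (star V) n;
                  g - f \<in> pos V n; h - g \<in> pos V n\<rbrakk>
                  \<Longrightarrow> mnorm V n g \<le> max (mnorm V n f) (mnorm V n h)"

subsection \<open>The matrix ordered dual\<close>

text \<open>\<open>V\<close> carries the norm of \<open>M\<^sub>1(V)\<close>.\<close>

definition banach_dual :: "'v::ab_group_add matrix_space \<Rightarrow> ('v \<Rightarrow> complex) set" where
  "banach_dual V = {\<phi>. Vector_Spaces.linear (scl V) (*) \<phi> \<and>
     (\<exists>K. \<forall>v. cmod (\<phi> v) \<le> K * mnorm V 1 (mat 1 1 (\<lambda>_. v)))}"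

definition dual_scl :: "complex \<Rightarrow> ('v \<Rightarrow> complex) \<Rightarrow> 'v \<Rightarrow> complex" where
  "dual_scl c \<phi> = (\<lambda>v. c * \<phi> v)"

definition dual_star :: "'v matrix_space \<Rightarrow> ('v \<Rightarrow> complex) \<Rightarrow> 'v \<Rightarrow> complex" where
  "dual_star V \<phi> = (\<lambda>v. cnj (\<phi> (star V v)))"

definition dual_mat :: "'v::ab_group_add matrix_space \<Rightarrow> nat \<Rightarrow> nat \<Rightarrow> ('v \<Rightarrow> complex) mat set" where
  "dual_mat V m n = {f \<in> carrier_mat m n. elements_mat f \<subseteq> banach_dual V}"

definition pairing :: "('v \<Rightarrow> complex) mat \<Rightarrow> 'v mat \<Rightarrow> complex" where
  "pairing f v = (\<Sum>i<dim_row f. \<Sum>j<dim_col f. (f $$ (i,j)) (v $$ (i,j)))"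

definition dual_norm :: "'v matrix_space \<Rightarrow> nat \<Rightarrow> ('v \<Rightarrow> complex) mat \<Rightarrow> real" where
  "dual_norm V n f = (SUP v\<in>{v \<in> carrier_mat n n. mnorm V n v \<le> 1}. cmod (pairing f v))"

definition dual_pos :: "'v::ab_group_add matrix_space \<Rightarrow> nat \<Rightarrow> ('v \<Rightarrow> complex) mat set" where
  "dual_pos V n = {f \<in> dual_mat V n n. mat_star (dual_star V) f = f \<and> (\<forall>v \<in> pos V n. 0 \<le> pairing f v)}"

definition Q_set :: "'v::ab_group_add matrix_space \<Rightarrow> nat \<Rightarrow> ('v \<Rightarrow> complex) mat set" where
  "Q_set V n = {f \<in> dual_pos V n. dual_norm V n f \<le> 1}"

definition S_set :: "'v::ab_group_add matrix_space \<Rightarrow> nat \<Rightarrow> ('v \<Rightarrow> complex) mat set" where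
  "S_set V n = {f \<in> Q_set V n. dual_norm V n f = 1}"

text \<open>Matrices of a fixed size do not form a type, so the convex hull of the library does not apply.\<close>

definition dual_convex :: "nat \<Rightarrow> ('v \<Rightarrow> complex) mat set \<Rightarrow> bool" where
  "dual_convex n T \<longleftrightarrow> T \<subseteq> carrier_mat n n \<and>
     (\<forall>f\<in>T. \<forall>g\<in>T. \<forall>s t. 0 \<le> s \<longrightarrow> 0 \<le> t \<longrightarrow> s + t = 1 \<longrightarrow>
        map_mat (dual_scl (complex_of_real s)) f + map_mat (dual_scl (complex_of_real t)) g \<in> T)"

definition dual_co :: "nat \<Rightarrow> ('v \<Rightarrow> complex) mat set \<Rightarrow> ('v \<Rightarrow> complex) mat set" where
  "dual_co n A = dual_convex n hull A"

end

theory Submission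
  imports Defs
begin

text \<open>
  Everything follows from one way of estimating functionals. A scalar matrix crosses the pairing
  between \<open>M\<^sub>n(V\<^sup>*)\<close> and \<open>M\<^sub>n(V)\<close>, so that a compression \<open>\<gamma>\<^sup>*f\<gamma>\<close> evaluated at \<open>v\<close> is \<open>f\<close> evaluated at a
  compression of \<open>v\<close> by \<open>\<gamma>\<^sup>T\<close>. Compressions of \<open>v\<close> preserve positivity, and compressions by contractions
  do not increase the norm (\<open>mnorm_bimod_contraction\<close>). Hence the compression of a positive functional
  by a contraction is positive and of no larger norm. The norm on \<open>V\<close> takes direct sums to maxima,
  and dually \<open>\<parallel>f\<^sub>1\<^sub>1\<parallel> + \<parallel>f\<^sub>2\<^sub>2\<parallel> \<le> \<parallel>f\<parallel>\<close> (\<open>dual_norm_diag_blocks\<close>). This one inequality bounds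
  both diagonal blocks and gives \<open>\<alpha>\<^sub>1 + \<alpha>\<^sub>2 \<le> 1\<close>.

  The rotation of the off-diagonal blocks by \<open>\<theta>\<close> is conjugation of \<open>f\<close> by a diagonal unitary. Half the difference
  of \<open>f\<close> and its rotation by \<open>\<pi>\<close> is the off-diagonal part of \<open>f\<close>, and the diagonal part is \<open>f\<close> evaluated at
  the diagonal part of \<open>v\<close>; so neither part has larger norm than \<open>f\<close>.

  The functional \<open>f\<^sub>1\<^sub>2 + f\<^sub>1\<^sub>2\<^sup>*\<close> is the difference of the compressions of \<open>f\<close> by the columns \<open>(I, I)/\<surd>2\<close>
  and \<open>(I, -I)/\<surd>2\<close>. Bounding each of the two by \<open>\<parallel>f\<parallel>\<close> would not suffice for membership in the convex
  hull; what is needed, and holds because the two columns together form a unitary, is that their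
  norms add up to at most \<open>\<parallel>f\<parallel>\<close> (\<open>off_diagonal_split\<close>).

  Finally, \<open>\<Oplus> \<gamma>\<^sub>i\<^sup>*g\<gamma>\<^sub>i\<close> at \<open>v\<close> is \<open>g\<close> at one compression of the block diagonal part of \<open>v\<close> by the column of
  the \<open>\<gamma>\<^sub>i\<^sup>T\<close>, and the hypothesis on \<open>\<Sum>\<gamma>\<^sub>i\<gamma>\<^sub>i\<^sup>*\<close> says that this column is a contraction
  (\<open>pairing_diag_block_mat\<close>, \<open>sum_cvec_norm_transpose_le\<close>).
\<close>

section \<open>Scalar contractions\<close>

lemma sum_lessThan_add:
  fixes f :: "nat \<Rightarrow> 'a::comm_monoid_add"
  shows "(\<Sum>i<m + n. f i) = (\<Sum>i<m. f i) + (\<Sum>i<n. f (m + i))"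
  by (induction n) (auto simp: add_ac)

lemma sum_if_const: "(\<Sum>x\<in>A. if P then f x else 0) = (if P then \<Sum>x\<in>A. f x else 0)"
  by simp

lemma dim_mat_adjoint [simp]:
  "dim_row (mat_adjoint A) = dim_col A" "dim_col (mat_adjoint A) = dim_row A"
  by (auto simp: mat_adjoint_def)

lemma mat_adjoint_carrier [simp]: "A \<in> carrier_mat m n \<Longrightarrow> mat_adjoint A \<in> carrier_mat n m"
  by (auto intro!: carrier_matI)

lemma index_mat_adjoint [simp]:
  fixes A :: "complex mat"
  shows "i < dim_col A \<Longrightarrow> j < dim_row A \<Longrightarrow> mat_adjoint A $$ (i,j) = cnj (A $$ (j,i))"
  by (simp add: mat_adjoint_def mat_of_rows_index)

lemma transpose_mat_adjoint:
  fixes A :: "complex mat"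
  shows "transpose_mat (mat_adjoint A) = mat_adjoint (transpose_mat A)"
  by (rule eq_matI) auto

lemma cvec_norm_nonneg [simp]: "0 \<le> cvec_norm x"
  by (simp add: cvec_norm_def L2_set_nonneg)

lemma cvec_norm_sq: "(cvec_norm x)\<^sup>2 = (\<Sum>i<dim_vec x. (cmod (x $ i))\<^sup>2)"
  by (simp add: cvec_norm_def L2_set_def sum_nonneg)

lemma cvec_norm_zero [simp]: "cvec_norm (0\<^sub>v n) = 0"
  by (simp add: cvec_norm_def L2_set_def)

lemma cvec_norm_append: "(cvec_norm (x @\<^sub>v y))\<^sup>2 = (cvec_norm x)\<^sup>2 + (cvec_norm y)\<^sup>2"
  by (simp add: cvec_norm_sq sum_lessThan_add)

lemma zero_mult_mat_vec: "dim_vec x = n \<Longrightarrow> 0\<^sub>m m n *\<^sub>v x = 0\<^sub>v m"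
  by (rule eq_vecI) (auto simp: scalar_prod_def)

lemma index_mult_vec: "i < dim_row A \<Longrightarrow> dim_vec x = dim_col A \<Longrightarrow>
    (A *\<^sub>v x) $ i = (\<Sum>k<dim_col A. A $$ (i,k) * x $ k)"
  by (simp add: scalar_prod_def lessThan_atLeast0)

lemma inner_self_eq_cvec_norm: "x \<bullet>c x = complex_of_real ((cvec_norm x)\<^sup>2)"
  by (simp add: scalar_prod_def cvec_norm_sq lessThan_atLeast0 complex_norm_square del: of_real_power)

lemma cmod_inner_le:
  assumes "dim_vec x = dim_vec y"
  shows "cmod (x \<bullet>c y) \<le> cvec_norm x * cvec_norm y"
proof -
  have "cmod (x \<bullet>c y) \<le> (\<Sum>i<dim_vec y. cmod (x $ i * cnj (y $ i)))"
    by (simp add: scalar_prod_def lessThan_atLeast0 norm_sum)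
  also have "\<dots> = (\<Sum>i<dim_vec y. \<bar>cmod (x $ i)\<bar> * \<bar>cmod (y $ i)\<bar>)"
    by (simp add: norm_mult)
  also have "\<dots> \<le> cvec_norm x * cvec_norm y"
    using L2_set_mult_ineq[of "\<lambda>i. cmod (x $ i)" "\<lambda>i. cmod (y $ i)" "{..<dim_vec y}"] assms
    by (simp add: cvec_norm_def)
  finally show ?thesis .
qed

lemma inner_mult_adjoint:
  fixes A :: "complex mat"
  assumes "A \<in> carrier_mat m n" "x \<in> carrier_vec n" "y \<in> carrier_vec m"
  shows "(A *\<^sub>v x) \<bullet>c y = x \<bullet>c (mat_adjoint A *\<^sub>v y)"
proof -
  have "(A *\<^sub>v x) \<bullet>c y = (\<Sum>i<m. \<Sum>k<n. A $$ (i,k) * x $ k * cnj (y $ i))"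
    using assms by (simp add: scalar_prod_def lessThan_atLeast0 sum_distrib_right)
  also have "\<dots> = (\<Sum>k<n. \<Sum>i<m. A $$ (i,k) * x $ k * cnj (y $ i))"
    by (rule sum.swap)
  also have "\<dots> = x \<bullet>c (mat_adjoint A *\<^sub>v y)"
    using assms by (simp add: scalar_prod_def lessThan_atLeast0 sum_distrib_left mult_ac)
  finally show ?thesis .
qed

definition contraction :: "complex mat \<Rightarrow> bool" where
  "contraction \<alpha> \<longleftrightarrow> (\<forall>x\<in>carrier_vec (dim_col \<alpha>). cvec_norm (\<alpha> *\<^sub>v x) \<le> cvec_norm x)"

lemma op_norm_contraction:
  assumes "contraction \<alpha>"
  shows "op_norm \<alpha> \<le> 1"
  unfolding op_norm_def
proof (rule cSUP_least)
  have "0\<^sub>v (dim_col \<alpha>) \<in> {x \<in> carrier_vec (dim_col \<alpha>). cvec_norm x \<le> 1}" by simp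
  then show "{x \<in> carrier_vec (dim_col \<alpha>). cvec_norm x \<le> 1} \<noteq> {}" by blast
  show "cvec_norm (\<alpha> *\<^sub>v x) \<le> 1" if "x \<in> {x \<in> carrier_vec (dim_col \<alpha>). cvec_norm x \<le> 1}" for x
    using that assms by (auto simp: contraction_def dest!: bspec[of _ _ x])
qed

lemma op_norm_nonneg:
  assumes "contraction \<alpha>"
  shows "0 \<le> op_norm \<alpha>"
proof -
  have "cvec_norm (\<alpha> *\<^sub>v x) \<le> 1" if "x \<in> {x \<in> carrier_vec (dim_col \<alpha>). cvec_norm x \<le> 1}" for x
    using that assms by (auto simp: contraction_def dest!: bspec[of _ _ x])
  then have "cvec_norm (\<alpha> *\<^sub>v 0\<^sub>v (dim_col \<alpha>)) \<le> op_norm \<alpha>"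
    unfolding op_norm_def by (intro cSUP_upper bdd_aboveI2[where M = 1]) auto
  then show ?thesis
    using cvec_norm_nonneg[of "\<alpha> *\<^sub>v 0\<^sub>v (dim_col \<alpha>)"] by linarith
qed

lemma contractionI_sq:
  assumes "\<And>x. x \<in> carrier_vec (dim_col \<alpha>) \<Longrightarrow> (cvec_norm (\<alpha> *\<^sub>v x))\<^sup>2 \<le> (cvec_norm x)\<^sup>2"
  shows "contraction \<alpha>"
  using assms by (auto simp: contraction_def intro: power2_le_imp_le)

lemma contractionD_sq:
  assumes "contraction \<alpha>" "x \<in> carrier_vec (dim_col \<alpha>)"
  shows "(cvec_norm (\<alpha> *\<^sub>v x))\<^sup>2 \<le> (cvec_norm x)\<^sup>2"
  using assms by (auto simp: contraction_def intro: power_mono)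

text \<open>This is \<open>\<parallel>\<alpha>\<^sup>*y\<parallel>\<^sup>2 = \<langle>\<alpha>\<alpha>\<^sup>*y, y\<rangle> \<le> \<parallel>\<alpha>\<^sup>*y\<parallel> \<parallel>y\<parallel>\<close>.\<close>

lemma contraction_adjoint:
  assumes "contraction \<alpha>"
  shows "contraction (mat_adjoint \<alpha>)"
  unfolding contraction_def
proof
  fix y :: "complex vec" assume y: "y \<in> carrier_vec (dim_col (mat_adjoint \<alpha>))"
  let ?z = "mat_adjoint \<alpha> *\<^sub>v y"
  have z: "?z \<in> carrier_vec (dim_col \<alpha>)" using y by (auto intro!: carrier_vecI)
  have "(\<alpha> *\<^sub>v ?z) \<bullet>c y = ?z \<bullet>c ?z"
    by (rule inner_mult_adjoint[of \<alpha> "dim_row \<alpha>" "dim_col \<alpha>"]) (use y z in auto)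
  then have "(cvec_norm ?z)\<^sup>2 = cmod ((\<alpha> *\<^sub>v ?z) \<bullet>c y)"
    by (simp only: inner_self_eq_cvec_norm norm_of_real) simp
  also have "\<dots> \<le> cvec_norm (\<alpha> *\<^sub>v ?z) * cvec_norm y"
    using y by (intro cmod_inner_le) auto
  also have "\<dots> \<le> cvec_norm ?z * cvec_norm y"
    using assms z by (intro mult_right_mono) (auto simp: contraction_def)
  finally show "cvec_norm ?z \<le> cvec_norm y"
    using cvec_norm_nonneg[of ?z] cvec_norm_nonneg[of y]
    by (cases "cvec_norm ?z = 0") (auto simp: power2_eq_square mult_le_cancel_left)
qed

text \<open>The matrix of the isometry \<open>e\<^sub>j \<mapsto> e\<^bsub>\<sigma> j\<^esub>\<close> from \<open>\<complex>\<^sup>a\<close> to \<open>\<complex>\<^sup>N\<close>.\<close>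

definition select_mat :: "nat \<Rightarrow> nat \<Rightarrow> (nat \<Rightarrow> nat) \<Rightarrow> complex mat" where
  "select_mat N a \<sigma> = mat N a (\<lambda>(i,j). if i = \<sigma> j then 1 else 0)"

lemma select_mat_carrier [simp]: "select_mat N a \<sigma> \<in> carrier_mat N a"
  by (simp add: select_mat_def)

lemma select_mat_contraction:
  assumes \<sigma>: "inj_on \<sigma> {..<a}" "\<sigma> ` {..<a} \<subseteq> {..<N}"
  shows "contraction (select_mat N a \<sigma>)"
proof (rule contractionI_sq)
  fix x :: "complex vec" assume x: "x \<in> carrier_vec (dim_col (select_mat N a \<sigma>))"
  let ?y = "select_mat N a \<sigma> *\<^sub>v x"
  have d: "dim_vec x = a" "dim_vec ?y = N" using x by (auto simp: select_mat_def)
  have y: "?y $ i = (\<Sum>j<a. if i = \<sigma> j then x $ j else 0)" if "i < N" for i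
    using that d by (subst index_mult_vec) (auto simp: select_mat_def intro!: sum.cong)
  have y1: "?y $ (\<sigma> j) = x $ j" if "j < a" for j
  proof -
    have "(\<Sum>l<a. if \<sigma> j = \<sigma> l then x $ l else 0) = (\<Sum>l<a. if j = l then x $ l else 0)"
      using that \<sigma>(1) by (intro sum.cong) (auto dest: inj_onD)
    then show ?thesis using that \<sigma>(2) by (subst y) auto
  qed
  have y0: "?y $ i = 0" if "i < N" "i \<notin> \<sigma> ` {..<a}" for i
    using that by (subst y) (auto intro!: sum.neutral)
  have "(cvec_norm ?y)\<^sup>2 = (\<Sum>i\<in>\<sigma> ` {..<a}. (cmod (?y $ i))\<^sup>2)"
    unfolding cvec_norm_sq d(2) by (rule sum.mono_neutral_right) (use \<sigma>(2) y0 in auto)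
  also have "\<dots> = (\<Sum>j<a. (cmod (x $ j))\<^sup>2)"
    using \<sigma>(1) by (simp add: sum.reindex y1)
  finally show "(cvec_norm ?y)\<^sup>2 \<le> (cvec_norm x)\<^sup>2" by (simp add: cvec_norm_sq d)
qed

section \<open>Two-sided multiplication by scalar matrices\<close>

lemma dim_bimod_mult [simp]:
  "dim_row (bimod_mult sc \<alpha> v \<beta>) = dim_row \<alpha>" "dim_col (bimod_mult sc \<alpha> v \<beta>) = dim_col \<beta>"
  by (simp_all add: bimod_mult_def)

lemma bimod_mult_carrier [simp]:
  "\<alpha> \<in> carrier_mat m k \<Longrightarrow> \<beta> \<in> carrier_mat l n \<Longrightarrow> bimod_mult sc \<alpha> v \<beta> \<in> carrier_mat m n"
  by (auto intro!: carrier_matI)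

lemma index_bimod_mult:
  "i < dim_row \<alpha> \<Longrightarrow> j < dim_col \<beta> \<Longrightarrow> bimod_mult sc \<alpha> v \<beta> $$ (i,j) =
     (\<Sum>k<dim_row v. \<Sum>l<dim_col v. sc (\<alpha> $$ (i,k) * \<beta> $$ (l,j)) (v $$ (k,l)))"
  by (simp add: bimod_mult_def)

lemma mat_direct_sum_carrier [simp]:
  "v \<in> carrier_mat m m' \<Longrightarrow> w \<in> carrier_mat n n' \<Longrightarrow> mat_direct_sum v w \<in> carrier_mat (m + n) (m' + n')"
  by (auto simp: mat_direct_sum_def)

lemma index_mat_direct_sum:
  assumes "v \<in> carrier_mat a a'" "w \<in> carrier_mat b b'"
  shows "i < a \<Longrightarrow> j < a' \<Longrightarrow> mat_direct_sum v w $$ (i,j) = v $$ (i,j)"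
    "i < a \<Longrightarrow> j < b' \<Longrightarrow> mat_direct_sum v w $$ (i,a' + j) = 0"
    "i < b \<Longrightarrow> j < a' \<Longrightarrow> mat_direct_sum v w $$ (a + i,j) = 0"
    "i < b \<Longrightarrow> j < b' \<Longrightarrow> mat_direct_sum v w $$ (a + i,a' + j) = w $$ (i,j)"
  using assms by (auto simp: mat_direct_sum_def)

lemma index_bimod_direct_sum:
  assumes "v \<in> carrier_mat a a'" "w \<in> carrier_mat b b'"
    and "\<alpha> \<in> carrier_mat m (a + b)" "\<beta> \<in> carrier_mat (a' + b') n" "i < m" "j < n"
    and sc: "\<And>c. sc c 0 = 0"
  shows "bimod_mult sc \<alpha> (mat_direct_sum v w) \<beta> $$ (i,j) =
    (\<Sum>k<a. \<Sum>l<a'. sc (\<alpha> $$ (i,k) * \<beta> $$ (l,j)) (v $$ (k,l))) +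
    (\<Sum>k<b. \<Sum>l<b'. sc (\<alpha> $$ (i,a + k) * \<beta> $$ (a' + l,j)) (w $$ (k,l)))"
proof -
  have d: "dim_row (mat_direct_sum v w) = a + b" "dim_col (mat_direct_sum v w) = a' + b'"
    using assms by (auto simp: mat_direct_sum_def)
  have "bimod_mult sc \<alpha> (mat_direct_sum v w) \<beta> $$ (i,j) = (\<Sum>k<a + b. \<Sum>l<a' + b'.
      sc (\<alpha> $$ (i,k) * \<beta> $$ (l,j)) (mat_direct_sum v w $$ (k,l)))"
    using assms by (simp add: index_bimod_mult d)
  then show ?thesis
    by (simp add: sum_lessThan_add index_mat_direct_sum[OF assms(1,2)] sc)
qed

text \<open>Passing to a submatrix is a two-sided product with isometries; this covers corners and single
  entries alike.\<close>

lemma bimod_mult_select_mat: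
  assumes v: "v \<in> carrier_mat M N"
    and \<sigma>: "\<And>i. i < a \<Longrightarrow> \<sigma> i < M" and \<tau>: "\<And>j. j < b \<Longrightarrow> \<tau> j < N"
    and sc: "\<And>v. sc 0 v = 0" "\<And>v. sc 1 v = v"
  shows "bimod_mult sc (mat_adjoint (select_mat M a \<sigma>)) v (select_mat N b \<tau>) =
    mat a b (\<lambda>(i,j). v $$ (\<sigma> i, \<tau> j))"
proof (rule eq_matI)
  fix i j assume "i < dim_row (mat a b (\<lambda>(i,j). v $$ (\<sigma> i, \<tau> j)))"
    "j < dim_col (mat a b (\<lambda>(i,j). v $$ (\<sigma> i, \<tau> j)))"
  then have ij: "i < a" "j < b" by auto
  have "bimod_mult sc (mat_adjoint (select_mat M a \<sigma>)) v (select_mat N b \<tau>) $$ (i,j) =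
      (\<Sum>k<M. \<Sum>l<N. if k = \<sigma> i then if l = \<tau> j then v $$ (\<sigma> i, \<tau> j) else 0 else 0)"
    using v ij by (simp add: index_bimod_mult select_mat_def) (intro sum.cong refl; auto simp: sc)
  also have "\<dots> = v $$ (\<sigma> i, \<tau> j)"
    using \<sigma>[OF ij(1)] \<tau>[OF ij(2)] by (simp add: sum_if_const)
  finally show "bimod_mult sc (mat_adjoint (select_mat M a \<sigma>)) v (select_mat N b \<tau>) $$ (i,j) =
      mat a b (\<lambda>(i,j). v $$ (\<sigma> i, \<tau> j)) $$ (i,j)"
    using ij by simp
qed (auto simp: select_mat_def)

lemma index_append_rows:
  assumes "A \<in> carrier_mat a n" "B \<in> carrier_mat b n" "j < n"
  shows "i < a \<Longrightarrow> (A @\<^sub>r B) $$ (i,j) = A $$ (i,j)"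
    and "i < b \<Longrightarrow> (A @\<^sub>r B) $$ (a + i,j) = B $$ (i,j)"
  using assms by (auto simp: append_rows_def)

text \<open>A sum \<open>\<gamma>\<^sup>*v\<gamma> + \<delta>\<^sup>*w\<delta>\<close> is one compression of the direct sum \<open>v \<oplus> w\<close>, by the column with blocks
  \<open>\<gamma>\<close> and \<open>\<delta>\<close>. A sum thus costs no more than the larger of the two norms, although the triangle
  inequality would add them.\<close>

lemma bimod_mult_append_rows:
  assumes v: "v \<in> carrier_mat a a" and w: "w \<in> carrier_mat b b"
    and \<gamma>: "\<gamma> \<in> carrier_mat a n" and \<delta>: "\<delta> \<in> carrier_mat b n" and sc: "\<And>c. sc c 0 = 0"
  shows "bimod_mult sc (mat_adjoint (\<gamma> @\<^sub>r \<delta>)) (mat_direct_sum v w) (\<gamma> @\<^sub>r \<delta>) =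
    bimod_mult sc (mat_adjoint \<gamma>) v \<gamma> + bimod_mult sc (mat_adjoint \<delta>) w \<delta>" (is "?L = ?R")
proof (rule eq_matI)
  have c: "\<gamma> @\<^sub>r \<delta> \<in> carrier_mat (a + b) n" using \<gamma> \<delta> by simp
  then show "dim_row ?L = dim_row ?R" "dim_col ?L = dim_col ?R" using \<delta> by auto
  have d: "dim_row (\<gamma> @\<^sub>r \<delta>) = a + b" "dim_col (\<gamma> @\<^sub>r \<delta>) = n" using c by auto
  fix i j assume "i < dim_row ?R" "j < dim_col ?R"
  then have ij: "i < n" "j < n" using \<delta> by auto
  show "?L $$ (i,j) = ?R $$ (i,j)"
    using ij \<gamma> \<delta> v w c d
    by (subst index_bimod_direct_sum[OF v w, where m = n and n = n])
       (auto simp: sc index_bimod_mult index_append_rows[OF \<gamma> \<delta>] index_mat_adjoint)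
qed

section \<open>Norms of compressions\<close>

text \<open>The matrix norms control only products with square scalar matrices; padded by zeros, a rectangular
  product becomes a corner of a square one.\<close>

lemma (in abstract_operator_space) mnorm_bimod_contraction:
  assumes n: "1 \<le> n" "1 \<le> N" and v: "v \<in> carrier_mat N N"
    and \<alpha>: "\<alpha> \<in> carrier_mat n N" "contraction \<alpha>" and \<beta>: "\<beta> \<in> carrier_mat N n" "contraction \<beta>"
  shows "mnorm V n (bimod_mult (scl V) \<alpha> v \<beta>) \<le> mnorm V N v"
proof -
  interpret vector_space "scl V" by (rule vector_space)
  define A where "A = four_block_mat (0\<^sub>m n n) \<alpha> (0\<^sub>m N n) (0\<^sub>m N N)"
  define B where "B = four_block_mat (0\<^sub>m n n) (0\<^sub>m n N) \<beta> (0\<^sub>m N N)"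
  have c: "A \<in> carrier_mat (n + N) (n + N)" "B \<in> carrier_mat (n + N) (n + N)"
    using \<alpha> \<beta> by (auto simp: A_def B_def)
  have A: "contraction A"
  proof (rule contractionI_sq)
    fix x :: "complex vec" assume "x \<in> carrier_vec (dim_col A)"
    then have x: "vec_first x n @\<^sub>v vec_last x N = x"
      using c by (intro vec_first_last_append) auto
    let ?y = "vec_last x N"
    have "A *\<^sub>v (vec_first x n @\<^sub>v ?y) = (0\<^sub>m n n *\<^sub>v vec_first x n + \<alpha> *\<^sub>v ?y) @\<^sub>v
        (0\<^sub>m N n *\<^sub>v vec_first x n + 0\<^sub>m N N *\<^sub>v ?y)"
      unfolding A_def using \<alpha> by (intro four_block_mat_mult_vec) auto
    also have "\<dots> = (\<alpha> *\<^sub>v ?y) @\<^sub>v 0\<^sub>v N"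
      using \<alpha>(1) by (simp add: zero_mult_mat_vec vec_first_def vec_last_def)
    finally have "(cvec_norm (A *\<^sub>v x))\<^sup>2 = (cvec_norm (\<alpha> *\<^sub>v ?y))\<^sup>2"
      by (simp add: x cvec_norm_append)
    also have "\<dots> \<le> (cvec_norm ?y)\<^sup>2"
      using \<alpha> by (intro contractionD_sq) auto
    also have "\<dots> \<le> (cvec_norm x)\<^sup>2"
      by (subst (2) x[symmetric]) (simp add: cvec_norm_append)
    finally show "(cvec_norm (A *\<^sub>v x))\<^sup>2 \<le> (cvec_norm x)\<^sup>2" .
  qed
  have B: "contraction B"
  proof (rule contractionI_sq)
    fix x :: "complex vec" assume "x \<in> carrier_vec (dim_col B)"
    then have x: "vec_first x n @\<^sub>v vec_last x N = x"
      using c by (intro vec_first_last_append) auto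
    let ?y = "vec_first x n"
    have "B *\<^sub>v (?y @\<^sub>v vec_last x N) = (0\<^sub>m n n *\<^sub>v ?y + 0\<^sub>m n N *\<^sub>v vec_last x N) @\<^sub>v
        (\<beta> *\<^sub>v ?y + 0\<^sub>m N N *\<^sub>v vec_last x N)"
      unfolding B_def using \<beta> by (intro four_block_mat_mult_vec) auto
    also have "\<dots> = 0\<^sub>v n @\<^sub>v (\<beta> *\<^sub>v ?y)"
      using \<beta>(1) by (simp add: zero_mult_mat_vec vec_first_def vec_last_def)
    finally have "(cvec_norm (B *\<^sub>v x))\<^sup>2 = (cvec_norm (\<beta> *\<^sub>v ?y))\<^sup>2"
      by (simp add: x cvec_norm_append)
    also have "\<dots> \<le> (cvec_norm ?y)\<^sup>2"
      using \<beta> by (intro contractionD_sq) auto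
    also have "\<dots> \<le> (cvec_norm x)\<^sup>2"
      by (subst (2) x[symmetric]) (simp add: cvec_norm_append)
    finally show "(cvec_norm (B *\<^sub>v x))\<^sup>2 \<le> (cvec_norm x)\<^sup>2" .
  qed
  let ?w = "mat_direct_sum (0\<^sub>m n n) v"
  have w: "?w \<in> carrier_mat (n + N) (n + N)" using v by simp
  have eq: "bimod_mult (scl V) A ?w B = mat_direct_sum (bimod_mult (scl V) \<alpha> v \<beta>) (0\<^sub>m N N)"
    (is "?L = ?R")
  proof (rule eq_matI)
    show "dim_row ?L = dim_row ?R" "dim_col ?L = dim_col ?R"
      using c \<alpha> \<beta> by (auto simp: mat_direct_sum_def)
    fix i j assume "i < dim_row ?R" "j < dim_col ?R"
    then have ij: "i < n + N" "j < n + N" using \<alpha> \<beta> by (auto simp: mat_direct_sum_def)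
    have A': "A $$ (i, n + k) = (if i < n then \<alpha> $$ (i,k) else 0)" if "k < N" for k
      using that ij \<alpha> by (auto simp: A_def)
    have B': "B $$ (n + l, j) = (if j < n then \<beta> $$ (l,j) else 0)" if "l < N" for l
      using that ij \<beta> by (auto simp: B_def)
    have "?L $$ (i,j) = (\<Sum>k<N. \<Sum>l<N. scl V (A $$ (i,n + k) * B $$ (n + l,j)) (v $$ (k,l)))"
      using ij v c by (subst index_bimod_direct_sum[where a = n and a' = n and b = N and b' = N]) auto
    also have "\<dots> = ?R $$ (i,j)"
      using ij \<alpha>(1) \<beta>(1) v
      by (auto simp: A' B' mat_direct_sum_def index_bimod_mult)
    finally show "?L $$ (i,j) = ?R $$ (i,j)" .
  qed
  have u: "bimod_mult (scl V) \<alpha> v \<beta> \<in> carrier_mat n n" (is "?u \<in> _")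
    using \<alpha>(1) \<beta>(1) by simp
  have z: "mnorm V k (0\<^sub>m k k) = 0" if "1 \<le> k" for k
    using that mnorm_eq_0[of k "0\<^sub>m k k"] by simp
  have "mnorm V n ?u = mnorm V (n + N) ?R"
    using mnorm_direct_sum[OF n u zero_carrier_mat] z[OF n(2)] mnorm_nonneg[OF n(1) u] by simp
  also have "\<dots> \<le> op_norm A * mnorm V (n + N) ?w * op_norm B"
    unfolding eq[symmetric] using n c w by (intro mnorm_bimod) auto
  also have "\<dots> \<le> 1 * mnorm V (n + N) ?w * 1"
    using op_norm_contraction[OF A] op_norm_contraction[OF B] op_norm_nonneg[OF A] op_norm_nonneg[OF B]
      mnorm_nonneg[of "n + N" ?w] n w
    by (intro mult_mono mult_nonneg_nonneg) auto
  also have "\<dots> = mnorm V N v"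
    using mnorm_direct_sum[OF n zero_carrier_mat v] z[OF n(1)] mnorm_nonneg[OF n(2) v] by simp
  finally show ?thesis .
qed

context abstract_operator_space begin

lemma mnorm_submatrix:
  assumes n: "1 \<le> a" "1 \<le> N" and v: "v \<in> carrier_mat N N"
    and \<sigma>: "inj_on \<sigma> {..<a}" "\<sigma> ` {..<a} \<subseteq> {..<N}"
    and \<tau>: "inj_on \<tau> {..<a}" "\<tau> ` {..<a} \<subseteq> {..<N}"
  shows "mnorm V a (mat a a (\<lambda>(i,j). v $$ (\<sigma> i, \<tau> j))) \<le> mnorm V N v"
proof -
  interpret vector_space "scl V" by (rule vector_space)
  have "bimod_mult (scl V) (mat_adjoint (select_mat N a \<sigma>)) v (select_mat N a \<tau>) =
      mat a a (\<lambda>(i,j). v $$ (\<sigma> i, \<tau> j))"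
    using \<sigma>(2) \<tau>(2) v by (intro bimod_mult_select_mat) auto
  moreover have "mnorm V a (bimod_mult (scl V) (mat_adjoint (select_mat N a \<sigma>)) v (select_mat N a \<tau>))
      \<le> mnorm V N v"
    using assms by (intro mnorm_bimod_contraction contraction_adjoint select_mat_contraction)
      (auto intro!: mat_adjoint_carrier)
  ultimately show ?thesis by simp
qed

lemma mnorm_diag_blocks:
  assumes n: "1 \<le> m" "1 \<le> n" and v: "v11 \<in> carrier_mat m m" "v12 \<in> carrier_mat m n"
    "v21 \<in> carrier_mat n m" "v22 \<in> carrier_mat n n"
  shows "mnorm V m v11 \<le> mnorm V (m + n) (four_block_mat v11 v12 v21 v22)"
    and "mnorm V n v22 \<le> mnorm V (m + n) (four_block_mat v11 v12 v21 v22)"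
proof -
  let ?v = "four_block_mat v11 v12 v21 v22"
  have 1: "mat m m (\<lambda>(i,j). ?v $$ (i, j)) = v11"
    by (rule eq_matI) (use v in auto)
  have 2: "mat n n (\<lambda>(i,j). ?v $$ (m + i, m + j)) = v22"
    by (rule eq_matI) (use v in auto)
  show "mnorm V m v11 \<le> mnorm V (m + n) ?v"
    using mnorm_submatrix[of m "m + n" ?v "\<lambda>i. i" "\<lambda>j. j"] n v unfolding 1 by auto
  show "mnorm V n v22 \<le> mnorm V (m + n) ?v"
  proof -
    have "(\<lambda>i. m + i) ` {..<n} \<subseteq> {..<m + n}" by (rule image_subsetI) simp
    then show ?thesis
      using mnorm_submatrix[of n "m + n" ?v "\<lambda>i. m + i" "\<lambda>j. m + j"] n v unfolding 2 by simp
  qed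
qed

text \<open>The last hypothesis is \<open>\<gamma>\<^sup>*\<gamma> + \<delta>\<^sup>*\<delta> \<le> I\<close>: it makes the column with blocks \<open>\<gamma>\<close> and \<open>\<delta>\<close> a
  contraction.\<close>

lemma mnorm_compress_add:
  assumes n: "1 \<le> n" "1 \<le> a" "1 \<le> b" and v: "v \<in> carrier_mat a a" and w: "w \<in> carrier_mat b b"
    and \<gamma>: "\<gamma> \<in> carrier_mat a n" and \<delta>: "\<delta> \<in> carrier_mat b n"
    and le: "\<And>x. x \<in> carrier_vec n \<Longrightarrow> (cvec_norm (\<gamma> *\<^sub>v x))\<^sup>2 + (cvec_norm (\<delta> *\<^sub>v x))\<^sup>2 \<le> (cvec_norm x)\<^sup>2"
  shows "mnorm V n (bimod_mult (scl V) (mat_adjoint \<gamma>) v \<gamma> + bimod_mult (scl V) (mat_adjoint \<delta>) w \<delta>)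
    \<le> max (mnorm V a v) (mnorm V b w)"
proof -
  interpret vector_space "scl V" by (rule vector_space)
  have c: "\<gamma> @\<^sub>r \<delta> \<in> carrier_mat (a + b) n" using \<gamma> \<delta> by simp
  have "contraction (\<gamma> @\<^sub>r \<delta>)"
    by (rule contractionI_sq) (use le c in \<open>auto simp: mat_mult_append[OF \<gamma> \<delta>] cvec_norm_append\<close>)
  then have "mnorm V n (bimod_mult (scl V) (mat_adjoint (\<gamma> @\<^sub>r \<delta>)) (mat_direct_sum v w) (\<gamma> @\<^sub>r \<delta>))
      \<le> mnorm V (a + b) (mat_direct_sum v w)"
    using n v w c by (intro mnorm_bimod_contraction contraction_adjoint mat_direct_sum_carrier
        mat_adjoint_carrier) auto
  then show ?thesis
    using v w \<gamma> \<delta> n by (simp add: bimod_mult_append_rows mnorm_direct_sum)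
qed

end

section \<open>Matrices of functionals\<close>

lemma sum_fun_apply: "(\<Sum>i\<in>A. f i) x = (\<Sum>i\<in>A. f i x :: 'a::comm_monoid_add)"
  by (induction A rule: infinite_finite_induct) auto

lemma dual_scl_apply [simp]: "dual_scl c \<phi> v = c * \<phi> v"
  by (simp add: dual_scl_def)

lemma index_dual_mat: "f \<in> dual_mat V m n \<Longrightarrow> i < m \<Longrightarrow> j < n \<Longrightarrow> f $$ (i,j) \<in> banach_dual V"
  by (auto simp: dual_mat_def)

lemma dual_matI:
  "f \<in> carrier_mat m n \<Longrightarrow> (\<And>i j. i < m \<Longrightarrow> j < n \<Longrightarrow> f $$ (i,j) \<in> banach_dual V) \<Longrightarrow> f \<in> dual_mat V m n"
  by (auto simp: dual_mat_def dest!: elements_matD)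

lemma dual_mat_carrier: "f \<in> dual_mat V m n \<Longrightarrow> f \<in> carrier_mat m n"
  by (simp add: dual_mat_def)

lemma banach_dual_add: "\<phi> \<in> banach_dual V \<Longrightarrow> \<phi> (u + v) = \<phi> u + \<phi> v"
  by (auto simp: banach_dual_def Vector_Spaces.linear_iff)

lemma banach_dual_scl: "\<phi> \<in> banach_dual V \<Longrightarrow> \<phi> (scl V c v) = c * \<phi> v"
  by (auto simp: banach_dual_def Vector_Spaces.linear_iff)

lemma banach_dual_zero: "\<phi> \<in> banach_dual V \<Longrightarrow> \<phi> 0 = 0"
  using banach_dual_add[of \<phi> V 0 0] by simp

lemma banach_dual_sum: "\<phi> \<in> banach_dual V \<Longrightarrow> \<phi> (\<Sum>i\<in>A. f i) = (\<Sum>i\<in>A. \<phi> (f i))"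
  by (induction A rule: infinite_finite_induct) (auto simp: banach_dual_add banach_dual_zero)

lemma pairing_eq:
  "f \<in> carrier_mat m n \<Longrightarrow> pairing f v = (\<Sum>i<m. \<Sum>j<n. (f $$ (i,j)) (v $$ (i,j)))"
  by (simp add: pairing_def)

lemma pairing_four_block:
  assumes "a \<in> carrier_mat m m'" "b \<in> carrier_mat m n'" "c \<in> carrier_mat n m'" "d \<in> carrier_mat n n'"
    and "v11 \<in> carrier_mat m m'" "v12 \<in> carrier_mat m n'" "v21 \<in> carrier_mat n m'" "v22 \<in> carrier_mat n n'"
  shows "pairing (four_block_mat a b c d) (four_block_mat v11 v12 v21 v22) =
    pairing a v11 + pairing b v12 + pairing c v21 + pairing d v22"
proof -
  have c: "four_block_mat a b c d \<in> carrier_mat (m + n) (m' + n')" using assms by simp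
  have "(\<Sum>i<m. \<Sum>j<m'. (four_block_mat a b c d $$ (i,j)) (four_block_mat v11 v12 v21 v22 $$ (i,j))) = pairing a v11"
    unfolding pairing_eq[OF assms(1)] by (intro sum.cong refl) (use assms in auto)
  moreover have "(\<Sum>i<m. \<Sum>j<n'. (four_block_mat a b c d $$ (i,m' + j)) (four_block_mat v11 v12 v21 v22 $$ (i,m' + j))) = pairing b v12"
    unfolding pairing_eq[OF assms(2)] by (intro sum.cong refl) (use assms in auto)
  moreover have "(\<Sum>i<n. \<Sum>j<m'. (four_block_mat a b c d $$ (m + i,j)) (four_block_mat v11 v12 v21 v22 $$ (m + i,j))) = pairing c v21"
    unfolding pairing_eq[OF assms(3)] by (intro sum.cong refl) (use assms in auto)
  moreover have "(\<Sum>i<n. \<Sum>j<n'. (four_block_mat a b c d $$ (m + i,m' + j)) (four_block_mat v11 v12 v21 v22 $$ (m + i,m' + j))) = pairing d v22"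
    unfolding pairing_eq[OF assms(4)] by (intro sum.cong refl) (use assms in auto)
  ultimately show ?thesis
    unfolding pairing_eq[OF c] by (simp add: sum_lessThan_add sum.distrib add_ac)
qed

lemma pairing_zero_mat [simp]: "pairing (0\<^sub>m m n) v = 0"
  by (simp add: pairing_def)

lemma pairing_map_scl: "pairing (map_mat (dual_scl c) f) v = c * pairing f v"
  by (simp add: pairing_def sum_distrib_left)

lemma pairing_of_zero: "f \<in> dual_mat V m n \<Longrightarrow> pairing f (0\<^sub>m m n) = 0"
  using index_dual_mat[of f V m n] dual_mat_carrier[of f V m n]
  by (simp add: pairing_eq banach_dual_zero[of _ V])

lemma pairing_add: "f \<in> dual_mat V m n \<Longrightarrow> u \<in> carrier_mat m n \<Longrightarrow> v \<in> carrier_mat m n \<Longrightarrow>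
    pairing f (u + v) = pairing f u + pairing f v"
  using index_dual_mat[of f V m n] dual_mat_carrier[of f V m n]
  by (simp add: pairing_eq banach_dual_add[of _ V] sum.distrib)

lemma pairing_scl: "f \<in> dual_mat V m n \<Longrightarrow> v \<in> carrier_mat m n \<Longrightarrow>
    pairing f (map_mat (scl V c) v) = c * pairing f v"
  using index_dual_mat[of f V m n] dual_mat_carrier[of f V m n]
  by (simp add: pairing_eq banach_dual_scl[of _ V] sum_distrib_left)

text \<open>The pairing is bilinear, with no conjugation, so scalar matrices cross it as transposes. For
  this reason the contractivity assumptions on functionals below concern \<open>\<gamma>\<^sup>T\<close> instead of \<open>\<gamma>\<close>.\<close>

lemma pairing_bimod_mult:
  assumes f: "f \<in> dual_mat V m n" and v: "v \<in> carrier_mat k l"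
    and \<alpha>: "\<alpha> \<in> carrier_mat k m" and \<beta>: "\<beta> \<in> carrier_mat n l"
  shows "pairing (bimod_mult dual_scl \<alpha> f \<beta>) v =
    pairing f (bimod_mult (scl V) (transpose_mat \<alpha>) v (transpose_mat \<beta>))"
proof -
  have fc: "f \<in> carrier_mat m n" using f by (rule dual_mat_carrier)
  let ?t = "\<lambda>i j p q. \<alpha> $$ (i,p) * \<beta> $$ (q,j) * (f $$ (p,q)) (v $$ (i,j))"
  have "pairing (bimod_mult dual_scl \<alpha> f \<beta>) v = (\<Sum>i<k. \<Sum>j<l. \<Sum>p<m. \<Sum>q<n. ?t i j p q)"
    unfolding pairing_eq[OF bimod_mult_carrier[OF \<alpha> \<beta>]]
    by (intro sum.cong refl) (use \<alpha> \<beta> fc in \<open>simp add: index_bimod_mult sum_fun_apply\<close>)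
  also have "\<dots> = (\<Sum>i<k. \<Sum>p<m. \<Sum>j<l. \<Sum>q<n. ?t i j p q)"
    by (rule sum.cong[OF refl], rule sum.swap)
  also have "\<dots> = (\<Sum>p<m. \<Sum>i<k. \<Sum>j<l. \<Sum>q<n. ?t i j p q)"
    by (rule sum.swap)
  also have "\<dots> = (\<Sum>p<m. \<Sum>i<k. \<Sum>q<n. \<Sum>j<l. ?t i j p q)"
    by (rule sum.cong[OF refl], rule sum.cong[OF refl], rule sum.swap)
  also have "\<dots> = (\<Sum>p<m. \<Sum>q<n. \<Sum>i<k. \<Sum>j<l. ?t i j p q)"
    by (rule sum.cong[OF refl], rule sum.swap)
  also have "\<dots> = pairing f (bimod_mult (scl V) (transpose_mat \<alpha>) v (transpose_mat \<beta>))"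
    unfolding pairing_eq[OF fc]
    by (intro sum.cong refl)
       (use \<alpha> \<beta> v index_dual_mat[OF f] in \<open>simp add: index_bimod_mult banach_dual_sum[of _ V] banach_dual_scl[of _ V]\<close>)
  finally show ?thesis .
qed

section \<open>The dual norm\<close>

context abstract_operator_space begin

lemma banach_dual_closed:
  shows "0 \<in> banach_dual V"
    and "\<phi> \<in> banach_dual V \<Longrightarrow> \<psi> \<in> banach_dual V \<Longrightarrow> \<phi> + \<psi> \<in> banach_dual V"
    and "\<phi> \<in> banach_dual V \<Longrightarrow> dual_scl c \<phi> \<in> banach_dual V"
proof -
  show "0 \<in> banach_dual V"
    by (auto simp: banach_dual_def Vector_Spaces.linear_iff vector_space
        vector_space_over_itself.vector_space_axioms intro!: exI[of _ 0])
next
  assume a: "\<phi> \<in> banach_dual V" "\<psi> \<in> banach_dual V"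
  then obtain K L where "\<And>v. cmod (\<phi> v) \<le> K * mnorm V 1 (mat 1 1 (\<lambda>_. v))"
    "\<And>v. cmod (\<psi> v) \<le> L * mnorm V 1 (mat 1 1 (\<lambda>_. v))"
    by (auto simp: banach_dual_def)
  then have "cmod (\<phi> v + \<psi> v) \<le> (K + L) * mnorm V 1 (mat 1 1 (\<lambda>_. v))" for v
    unfolding distrib_right by (rule order_trans[OF norm_triangle_ineq add_mono])
  then have "\<exists>K. \<forall>v. cmod ((\<phi> + \<psi>) v) \<le> K * mnorm V 1 (mat 1 1 (\<lambda>_. v))"
    by auto
  with a show "\<phi> + \<psi> \<in> banach_dual V"
    by (auto simp: banach_dual_def Vector_Spaces.linear_iff algebra_simps)
next
  assume a: "\<phi> \<in> banach_dual V"
  then obtain K where "\<And>v. cmod (\<phi> v) \<le> K * mnorm V 1 (mat 1 1 (\<lambda>_. v))"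
    by (auto simp: banach_dual_def)
  then have "cmod (dual_scl c \<phi> v) \<le> (cmod c * K) * mnorm V 1 (mat 1 1 (\<lambda>_. v))" for v
    unfolding dual_scl_apply norm_mult mult.assoc by (intro mult_left_mono) auto
  then have "\<exists>K. \<forall>v. cmod (dual_scl c \<phi> v) \<le> K * mnorm V 1 (mat 1 1 (\<lambda>_. v))"
    by auto
  with a show "dual_scl c \<phi> \<in> banach_dual V"
    by (auto simp: banach_dual_def Vector_Spaces.linear_iff algebra_simps)
qed

lemma banach_dual_sum_closed:
  "(\<And>i. i \<in> A \<Longrightarrow> f i \<in> banach_dual V) \<Longrightarrow> (\<Sum>i\<in>A. f i) \<in> banach_dual V"
  by (induction A rule: infinite_finite_induct) (auto intro: banach_dual_closed)

lemma bimod_mult_dual_mat: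
  assumes "f \<in> dual_mat V m n" "\<alpha> \<in> carrier_mat k m" "\<beta> \<in> carrier_mat n l"
  shows "bimod_mult dual_scl \<alpha> f \<beta> \<in> dual_mat V k l"
  using assms dual_mat_carrier[OF assms(1)]
  by (intro dual_matI) (auto simp: index_bimod_mult intro!: banach_dual_sum_closed banach_dual_closed index_dual_mat)

lemma map_scl_dual_mat: "f \<in> dual_mat V m n \<Longrightarrow> map_mat (dual_scl c) f \<in> dual_mat V m n"
  using dual_mat_carrier[of f V m n]
  by (intro dual_matI) (auto intro!: banach_dual_closed index_dual_mat)

lemma four_block_dual_mat:
  assumes "a \<in> dual_mat V m m'" "b \<in> dual_mat V m n'" "c \<in> dual_mat V n m'" "d \<in> dual_mat V n n'"
  shows "four_block_mat a b c d \<in> dual_mat V (m + n) (m' + n')"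
  using assms[THEN dual_mat_carrier]
  by (intro dual_matI) (auto intro!: index_dual_mat[OF assms(1)] index_dual_mat[OF assms(2)]
      index_dual_mat[OF assms(3)] index_dual_mat[OF assms(4)])

lemma zero_dual_mat: "0\<^sub>m m n \<in> dual_mat V m n"
  by (intro dual_matI) (auto intro: banach_dual_closed)

lemma mnorm_zero: "1 \<le> n \<Longrightarrow> mnorm V n (0\<^sub>m n n) = 0"
  using mnorm_eq_0[of n "0\<^sub>m n n"] by simp

text \<open>The supremum that defines the dual norm is a genuine one: every entry of \<open>f\<close> is bounded, and no
  entry of \<open>v\<close> has larger norm than \<open>v\<close>, being a submatrix.\<close>

lemma bdd_above_pairing:
  assumes n: "1 \<le> n" and f: "f \<in> dual_mat V n n"
  shows "bdd_above ((\<lambda>v. cmod (pairing f v)) ` {v \<in> carrier_mat n n. mnorm V n v \<le> 1})"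
proof -
  have "\<exists>K. \<forall>v. cmod ((f $$ (i,j)) v) \<le> K * mnorm V 1 (mat 1 1 (\<lambda>_. v))" if "i < n" "j < n" for i j
    using index_dual_mat[OF f that] by (auto simp: banach_dual_def)
  then obtain K where K: "\<And>i j v. i < n \<Longrightarrow> j < n \<Longrightarrow>
      cmod ((f $$ (i,j)) v) \<le> K i j * mnorm V 1 (mat 1 1 (\<lambda>_. v))"
    by metis
  have "cmod (pairing f v) \<le> (\<Sum>i<n. \<Sum>j<n. \<bar>K i j\<bar>)"
    if v: "v \<in> carrier_mat n n" "mnorm V n v \<le> 1" for v
  proof -
    have "cmod ((f $$ (i,j)) (v $$ (i,j))) \<le> \<bar>K i j\<bar>" if ij: "i < n" "j < n" for i j
    proof -
      have 1: "mat 1 1 (\<lambda>(p,q). v $$ (i,j)) = mat 1 1 (\<lambda>_. v $$ (i,j))" by auto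
      have "mnorm V 1 (mat 1 1 (\<lambda>_. v $$ (i,j))) \<le> mnorm V n v"
        using mnorm_submatrix[of 1 n v "\<lambda>_. i" "\<lambda>_. j"] n v ij unfolding 1
        by (auto simp: inj_on_def)
      then have "\<bar>K i j\<bar> * mnorm V 1 (mat 1 1 (\<lambda>_. v $$ (i,j))) \<le> \<bar>K i j\<bar> * 1"
        using v by (intro mult_left_mono) auto
      moreover have "K i j * mnorm V 1 (mat 1 1 (\<lambda>_. v $$ (i,j))) \<le> \<bar>K i j\<bar> * mnorm V 1 (mat 1 1 (\<lambda>_. v $$ (i,j)))"
        by (intro mult_right_mono mnorm_nonneg) auto
      ultimately show ?thesis using K[OF ij, of "v $$ (i,j)"] by linarith
    qed
    then have "(\<Sum>i<n. \<Sum>j<n. cmod ((f $$ (i,j)) (v $$ (i,j)))) \<le> (\<Sum>i<n. \<Sum>j<n. \<bar>K i j\<bar>)"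
      by (intro sum_mono) auto
    moreover have "cmod (pairing f v) \<le> (\<Sum>i<n. \<Sum>j<n. cmod ((f $$ (i,j)) (v $$ (i,j))))"
      unfolding pairing_eq[OF dual_mat_carrier[OF f]]
      by (rule order_trans[OF norm_sum sum_mono[OF norm_sum]])
    ultimately show ?thesis by linarith
  qed
  then show ?thesis by (intro bdd_aboveI2) auto
qed

lemma dual_norm_upper:
  "1 \<le> n \<Longrightarrow> f \<in> dual_mat V n n \<Longrightarrow> v \<in> carrier_mat n n \<Longrightarrow> mnorm V n v \<le> 1 \<Longrightarrow>
    cmod (pairing f v) \<le> dual_norm V n f"
  unfolding dual_norm_def by (intro cSUP_upper bdd_above_pairing) auto

lemma dual_norm_least:
  assumes n: "1 \<le> n"
    and le: "\<And>v. v \<in> carrier_mat n n \<Longrightarrow> mnorm V n v \<le> 1 \<Longrightarrow> cmod (pairing f v) \<le> C"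
  shows "dual_norm V n f \<le> C"
  unfolding dual_norm_def
proof (rule cSUP_least)
  have "0\<^sub>m n n \<in> {v \<in> carrier_mat n n. mnorm V n v \<le> 1}" using n by (simp add: mnorm_zero)
  then show "{v \<in> carrier_mat n n. mnorm V n v \<le> 1} \<noteq> {}" by blast
qed (use le in auto)

lemma dual_norm_nonneg: "1 \<le> n \<Longrightarrow> f \<in> dual_mat V n n \<Longrightarrow> 0 \<le> dual_norm V n f"
  using dual_norm_upper[of n f "0\<^sub>m n n"] by (simp add: mnorm_zero pairing_of_zero)

lemma dual_norm_scl:
  assumes n: "1 \<le> n" and f: "f \<in> dual_mat V n n" and r: "0 \<le> r"
  shows "dual_norm V n (map_mat (dual_scl (complex_of_real r)) f) = r * dual_norm V n f"
proof (rule antisym)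
  show "dual_norm V n (map_mat (dual_scl (complex_of_real r)) f) \<le> r * dual_norm V n f"
    using n f r by (intro dual_norm_least)
      (auto simp: pairing_map_scl norm_mult intro!: mult_left_mono dual_norm_upper)
  show "r * dual_norm V n f \<le> dual_norm V n (map_mat (dual_scl (complex_of_real r)) f)"
  proof (cases "r = 0")
    case True
    then show ?thesis using dual_norm_nonneg[OF n map_scl_dual_mat[OF f]] by simp
  next
    case False
    have "dual_norm V n f \<le> dual_norm V n (map_mat (dual_scl (complex_of_real r)) f) / r"
    proof (rule dual_norm_least[OF n])
      fix v assume "v \<in> carrier_mat n n" "mnorm V n v \<le> 1"
      from dual_norm_upper[OF n map_scl_dual_mat[OF f] this, of "complex_of_real r"]
      show "cmod (pairing f v) \<le> dual_norm V n (map_mat (dual_scl (complex_of_real r)) f) / r"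
        using r False by (simp add: pairing_map_scl norm_mult field_simps)
    qed
    then show ?thesis using r False by (simp add: field_simps)
  qed
qed

text \<open>Multiplying \<open>v\<close> and \<open>w\<close> by phases makes both values nonnegative reals, so that the modulus of
  their sum is the sum of their moduli; the suprema can then be taken one after the other.\<close>

lemma dual_norm_add_le:
  assumes m: "1 \<le> m" and n: "1 \<le> n" and f: "f \<in> dual_mat V m m" and g: "g \<in> dual_mat V n n"
    and le: "\<And>v w. v \<in> carrier_mat m m \<Longrightarrow> mnorm V m v \<le> 1 \<Longrightarrow> w \<in> carrier_mat n n \<Longrightarrow> mnorm V n w \<le> 1
      \<Longrightarrow> cmod (pairing f v + pairing g w) \<le> C"
  shows "dual_norm V m f + dual_norm V n g \<le> C"
proof -
  have phase: "\<exists>c. cmod c = 1 \<and> c * z = complex_of_real (cmod z)" for z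
  proof (cases "z = 0")
    case False
    then show ?thesis
      by (intro exI[of _ "cnj z / complex_of_real (cmod z)"])
        (simp add: norm_divide field_simps complex_norm_square[symmetric] power2_eq_square)
  qed (auto intro: exI[of _ 1])
  have "cmod (pairing f v) + cmod (pairing g w) \<le> C"
    if v: "v \<in> carrier_mat m m" "mnorm V m v \<le> 1" and w: "w \<in> carrier_mat n n" "mnorm V n w \<le> 1" for v w
  proof -
    obtain c d where c: "cmod c = 1" "c * pairing f v = complex_of_real (cmod (pairing f v))"
      and d: "cmod d = 1" "d * pairing g w = complex_of_real (cmod (pairing g w))"
      using phase by metis
    have "cmod (pairing f (map_mat (scl V c) v) + pairing g (map_mat (scl V d) w)) \<le> C"
      using v w c d m n by (intro le) (auto simp: mnorm_scl)
    also have "pairing f (map_mat (scl V c) v) + pairing g (map_mat (scl V d) w) =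
        complex_of_real (cmod (pairing f v) + cmod (pairing g w))"
      by (simp add: pairing_scl[OF f v(1)] pairing_scl[OF g w(1)] c d)
    finally show ?thesis
      unfolding norm_of_real by simp
  qed
  then have "dual_norm V m f \<le> C - cmod (pairing g w)"
    if "w \<in> carrier_mat n n" "mnorm V n w \<le> 1" for w
    using that m by (intro dual_norm_least) (auto simp: algebra_simps)
  then have "dual_norm V n g \<le> C - dual_norm V m f"
    using n by (intro dual_norm_least) (auto simp: algebra_simps)
  then show ?thesis by linarith
qed

text \<open>Each entry of \<open>f\<close> is detected by matrices with a single nonzero entry.\<close>

lemma dual_norm_eq_0:
  assumes n: "1 \<le> n" and f: "f \<in> dual_mat V n n" and z: "dual_norm V n f \<le> 0"
  shows "f = 0\<^sub>m n n"
proof (rule eq_matI)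
  interpret vector_space "scl V" by (rule vector_space)
  fix i j assume "i < dim_row (0\<^sub>m n n :: ('v \<Rightarrow> complex) mat)" "j < dim_col (0\<^sub>m n n :: ('v \<Rightarrow> complex) mat)"
  then have ij: "i < n" "j < n" by auto
  have "(f $$ (i,j)) v = 0" for v
  proof -
    define u where "u = mat n n (\<lambda>(p,q). if p = i \<and> q = j then v else 0)"
    \<comment> \<open>The summand 1 keeps the scaling factor positive when \<open>u\<close> vanishes.\<close>
    define c where "c = mnorm V n u + 1"
    have u: "u \<in> carrier_mat n n" by (simp add: u_def)
    have c: "0 < c" "mnorm V n u \<le> c" using mnorm_nonneg[OF n u] by (auto simp: c_def)
    have "pairing f u = (\<Sum>p<n. \<Sum>q<n. if p = i then if q = j then (f $$ (i,j)) v else 0 else 0)"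
      unfolding pairing_eq[OF dual_mat_carrier[OF f]]
      by (intro sum.cong refl) (use index_dual_mat[OF f] in \<open>auto simp: u_def banach_dual_zero[of _ V]\<close>)
    also have "\<dots> = (f $$ (i,j)) v" using ij by (simp add: sum_if_const)
    finally have 1: "pairing f u = (f $$ (i,j)) v" .
    have "cmod (pairing f (map_mat (scl V (complex_of_real (1 / c))) u)) \<le> dual_norm V n f"
      using c u n mnorm_nonneg[OF n u] by (intro dual_norm_upper f) (auto simp: mnorm_scl field_simps norm_divide)
    then have "cmod ((f $$ (i,j)) v) / c \<le> dual_norm V n f"
      using c by (simp add: pairing_scl[OF f u] 1 norm_mult norm_divide)
    also note z
    finally have "cmod ((f $$ (i,j)) v) \<le> 0"
      using c by (simp add: divide_le_0_iff)
    then show ?thesis by simp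
  qed
  then show "f $$ (i,j) = 0\<^sub>m n n $$ (i,j)" using ij by auto
qed (use dual_mat_carrier[OF f] in auto)

end

section \<open>Operations on positive functionals\<close>

lemma (in cstar_ordered_operator_space) pos_diag_blocks:
  assumes n: "1 \<le> m" "1 \<le> n" and v: "v11 \<in> carrier_mat m m" "v12 \<in> carrier_mat m n"
    "v21 \<in> carrier_mat n m" "v22 \<in> carrier_mat n n"
    and pos: "four_block_mat v11 v12 v21 v22 \<in> pos V (m + n)" (is "?v \<in> _")
  shows "v11 \<in> pos V m" and "v22 \<in> pos V n"
proof -
  interpret vector_space "scl V" by (rule vector_space)
  have c: "?v \<in> carrier_mat (m + n) (m + n)" using v by simp
  have 1: "mat m m (\<lambda>(i,j). ?v $$ (i, j)) = v11"
    by (rule eq_matI) (use v in auto)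
  have 2: "mat n n (\<lambda>(i,j). ?v $$ (m + i, m + j)) = v22"
    by (rule eq_matI) (use v in auto)
  have "bimod_mult (scl V) (mat_adjoint (select_mat (m + n) m (\<lambda>i. i))) ?v (select_mat (m + n) m (\<lambda>i. i)) = v11"
    by (rule trans[OF bimod_mult_select_mat[OF c, of m "\<lambda>i. i" m "\<lambda>i. i"] 1]) auto
  then show "v11 \<in> pos V m"
    using pos_compress[of "m + n" m "select_mat (m + n) m (\<lambda>i. i)" ?v] n pos by simp
  have "bimod_mult (scl V) (mat_adjoint (select_mat (m + n) n (\<lambda>i. m + i))) ?v (select_mat (m + n) n (\<lambda>i. m + i)) = v22"
    by (rule trans[OF bimod_mult_select_mat[OF c, of n "\<lambda>i. m + i" n "\<lambda>i. m + i"] 2]) auto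
  then show "v22 \<in> pos V n"
    using pos_compress[of "m + n" n "select_mat (m + n) n (\<lambda>i. m + i)" ?v] n pos by simp
qed

lemma four_block_mat_exists:
  assumes "v \<in> carrier_mat (m + n) (m + n)"
  obtains v11 v12 v21 v22 where "v11 \<in> carrier_mat m m" "v12 \<in> carrier_mat m n"
    "v21 \<in> carrier_mat n m" "v22 \<in> carrier_mat n n" "v = four_block_mat v11 v12 v21 v22"
  using assms split_block[of v m m _ _ _ _ n n] by (cases "split_block v m m") auto

lemma pairing_compress:
  assumes g: "g \<in> dual_mat V n n" and \<gamma>: "\<gamma> \<in> carrier_mat n k" and v: "v \<in> carrier_mat k k"
  shows "pairing (bimod_mult dual_scl (mat_adjoint \<gamma>) g \<gamma>) v =
    pairing g (bimod_mult (scl V) (mat_adjoint (transpose_mat \<gamma>)) v (transpose_mat \<gamma>))"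
  using pairing_bimod_mult[OF g v mat_adjoint_carrier[OF \<gamma>] \<gamma>] by (simp only: transpose_mat_adjoint)

lemma mat_star_bimod_mult:
  assumes g: "g \<in> carrier_mat n n" "mat_star (dual_star V) g = g" and \<gamma>: "\<gamma> \<in> carrier_mat n k"
  shows "mat_star (dual_star V) (bimod_mult dual_scl (mat_adjoint \<gamma>) g \<gamma>) =
    bimod_mult dual_scl (mat_adjoint \<gamma>) g \<gamma>" (is "?L = ?R")
proof (rule eq_matI)
  show "dim_row ?L = dim_row ?R" "dim_col ?L = dim_col ?R" by (auto simp: mat_star_def)
  fix i j assume "i < dim_row ?R" "j < dim_col ?R"
  then have ij: "i < k" "j < k" using \<gamma> by auto
  have g': "cnj ((g $$ (p,q)) (star V x)) = (g $$ (q,p)) x" if "p < n" "q < n" for p q x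
  proof -
    have "mat_star (dual_star V) g $$ (q,p) = g $$ (q,p)" by (simp add: g)
    then show ?thesis using that g(1) by (simp add: mat_star_def dual_star_def fun_eq_iff)
  qed
  show "?L $$ (i,j) = ?R $$ (i,j)"
  proof
    fix x
    have "(?L $$ (i,j)) x = (\<Sum>p<n. \<Sum>q<n. \<gamma> $$ (p,j) * cnj (\<gamma> $$ (q,i)) * (g $$ (q,p)) x)"
      using ij \<gamma> g(1) by (simp add: mat_star_def dual_star_def index_bimod_mult sum_fun_apply g')
    also have "\<dots> = (\<Sum>q<n. \<Sum>p<n. \<gamma> $$ (p,j) * cnj (\<gamma> $$ (q,i)) * (g $$ (q,p)) x)"
      by (rule sum.swap)
    also have "\<dots> = (?R $$ (i,j)) x"
      using ij \<gamma> g(1) by (simp add: index_bimod_mult sum_fun_apply mult_ac)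
    finally show "(?L $$ (i,j)) x = (?R $$ (i,j)) x" .
  qed
qed

lemma mat_star_direct_sum:
  assumes a: "a \<in> carrier_mat m m" "mat_star (dual_star V) a = a"
    and b: "b \<in> carrier_mat n n" "mat_star (dual_star V) b = b"
  shows "mat_star (dual_star V) (mat_direct_sum a b) = mat_direct_sum a b"
proof (rule eq_matI)
  have c: "mat_direct_sum a b \<in> carrier_mat (m + n) (m + n)" using a b by simp
  then show "dim_row (mat_star (dual_star V) (mat_direct_sum a b)) = dim_row (mat_direct_sum a b)"
    "dim_col (mat_star (dual_star V) (mat_direct_sum a b)) = dim_col (mat_direct_sum a b)"
    by (auto simp: mat_star_def)
  fix i j assume "i < dim_row (mat_direct_sum a b)" "j < dim_col (mat_direct_sum a b)"
  then have ij: "i < m + n" "j < m + n" using c by auto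
  have z: "dual_star V 0 = 0" by (auto simp: dual_star_def)
  have a': "dual_star V (a $$ (q,p)) = a $$ (p,q)" if "p < m" "q < m" for p q
    using that a(1) arg_cong[OF a(2), of "\<lambda>M. M $$ (p,q)"] by (simp add: mat_star_def)
  have b': "dual_star V (b $$ (q,p)) = b $$ (p,q)" if "p < n" "q < n" for p q
    using that b(1) arg_cong[OF b(2), of "\<lambda>M. M $$ (p,q)"] by (simp add: mat_star_def)
  show "mat_star (dual_star V) (mat_direct_sum a b) $$ (i,j) = mat_direct_sum a b $$ (i,j)"
    using ij a(1) b(1) c by (auto simp: mat_star_def mat_direct_sum_def z a' b')
qed

context cstar_ordered_operator_space begin

lemma dual_posD:
  assumes "f \<in> dual_pos V n"
  shows "f \<in> dual_mat V n n" "f \<in> carrier_mat n n" "mat_star (dual_star V) f = f"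
    "v \<in> pos V n \<Longrightarrow> 0 \<le> pairing f v"
  using assms by (auto simp: dual_pos_def dual_mat_def)

lemma pos_carrier: "1 \<le> n \<Longrightarrow> v \<in> pos V n \<Longrightarrow> v \<in> carrier_mat n n"
  using pos_sa[of n] by (auto simp: mat_sa_def)

lemma dual_pos_bimod_mult:
  assumes n: "1 \<le> n" "1 \<le> k" and g: "g \<in> dual_pos V n" and \<gamma>: "\<gamma> \<in> carrier_mat n k"
  shows "bimod_mult dual_scl (mat_adjoint \<gamma>) g \<gamma> \<in> dual_pos V k"
  unfolding dual_pos_def
proof (intro CollectI conjI ballI)
  show "bimod_mult dual_scl (mat_adjoint \<gamma>) g \<gamma> \<in> dual_mat V k k"
    using \<gamma> by (intro bimod_mult_dual_mat[OF dual_posD(1)[OF g]]) auto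
  show "mat_star (dual_star V) (bimod_mult dual_scl (mat_adjoint \<gamma>) g \<gamma>) = bimod_mult dual_scl (mat_adjoint \<gamma>) g \<gamma>"
    by (rule mat_star_bimod_mult[OF dual_posD(2,3)[OF g] \<gamma>])
  fix v assume v: "v \<in> pos V k"
  have "pairing (bimod_mult dual_scl (mat_adjoint \<gamma>) g \<gamma>) v =
      pairing g (bimod_mult (scl V) (mat_adjoint (transpose_mat \<gamma>)) v (transpose_mat \<gamma>))"
    by (rule pairing_compress[OF dual_posD(1)[OF g] \<gamma> pos_carrier[OF n(2) v]])
  moreover have "bimod_mult (scl V) (mat_adjoint (transpose_mat \<gamma>)) v (transpose_mat \<gamma>) \<in> pos V n"
    using n v \<gamma> by (intro pos_compress[of k]) auto
  ultimately show "0 \<le> pairing (bimod_mult dual_scl (mat_adjoint \<gamma>) g \<gamma>) v"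
    using dual_posD(4)[OF g] by simp
qed

lemma dual_norm_bimod_mult_le:
  assumes n: "1 \<le> n" "1 \<le> k" and g: "g \<in> dual_mat V n n" and \<gamma>: "\<gamma> \<in> carrier_mat n k"
    and contr: "contraction (transpose_mat \<gamma>)"
  shows "dual_norm V k (bimod_mult dual_scl (mat_adjoint \<gamma>) g \<gamma>) \<le> dual_norm V n g"
proof (rule dual_norm_least[OF n(2)])
  fix v assume v: "v \<in> carrier_mat k k" "mnorm V k v \<le> 1"
  let ?w = "bimod_mult (scl V) (mat_adjoint (transpose_mat \<gamma>)) v (transpose_mat \<gamma>)"
  have "pairing (bimod_mult dual_scl (mat_adjoint \<gamma>) g \<gamma>) v = pairing g ?w"
    by (rule pairing_compress[OF g \<gamma> v(1)])
  moreover have "mnorm V n ?w \<le> mnorm V k v"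
    using n v \<gamma> contr by (intro mnorm_bimod_contraction contraction_adjoint mat_adjoint_carrier) auto
  moreover have "?w \<in> carrier_mat n n" using \<gamma> by (intro bimod_mult_carrier) auto
  ultimately show "cmod (pairing (bimod_mult dual_scl (mat_adjoint \<gamma>) g \<gamma>) v) \<le> dual_norm V n g"
    using dual_norm_upper[OF n(1) g, of ?w] v by simp
qed

lemma dual_pos_direct_sum:
  assumes n: "1 \<le> m" "1 \<le> n" and a: "a \<in> dual_pos V m" and b: "b \<in> dual_pos V n"
  shows "mat_direct_sum a b \<in> dual_pos V (m + n)"
  unfolding dual_pos_def
proof (intro CollectI conjI ballI)
  have ac: "a \<in> carrier_mat m m" and bc: "b \<in> carrier_mat n n"
    using a b by (auto intro: dual_posD)
  then have eq: "mat_direct_sum a b = four_block_mat a (0\<^sub>m m n) (0\<^sub>m n m) b"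
    by (auto simp: mat_direct_sum_def)
  show "mat_direct_sum a b \<in> dual_mat V (m + n) (m + n)"
    unfolding eq using a b by (intro four_block_dual_mat zero_dual_mat dual_posD)
  show "mat_star (dual_star V) (mat_direct_sum a b) = mat_direct_sum a b"
    using a b by (intro mat_star_direct_sum dual_posD)
  fix v assume v: "v \<in> pos V (m + n)"
  then have "v \<in> carrier_mat (m + n) (m + n)" using n by (intro pos_carrier) auto
  then obtain v11 v12 v21 v22 where c: "v11 \<in> carrier_mat m m" "v12 \<in> carrier_mat m n"
    "v21 \<in> carrier_mat n m" "v22 \<in> carrier_mat n n" and veq: "v = four_block_mat v11 v12 v21 v22"
    by (rule four_block_mat_exists)
  have "pairing (mat_direct_sum a b) v = pairing a v11 + pairing b v22"
    unfolding eq veq using pairing_four_block[OF ac zero_carrier_mat zero_carrier_mat bc c] by simp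
  moreover have "v11 \<in> pos V m" "v22 \<in> pos V n"
    using pos_diag_blocks[OF n c] v veq by auto
  ultimately show "0 \<le> pairing (mat_direct_sum a b) v"
    using dual_posD(4)[OF a] dual_posD(4)[OF b] by simp
qed

lemma dual_pos_scl:
  assumes n: "1 \<le> n" and f: "f \<in> dual_pos V n" and r: "0 \<le> r"
  shows "map_mat (dual_scl (complex_of_real r)) f \<in> dual_pos V n"
proof -
  have "dual_star V (dual_scl (complex_of_real r) (f $$ (j,i))) = dual_scl (complex_of_real r) (f $$ (i,j))"
    if "i < n" "j < n" for i j
    using that dual_posD(2)[OF f] arg_cong[OF dual_posD(3)[OF f], of "\<lambda>M. M $$ (i,j)"]
    by (simp add: mat_star_def dual_star_def fun_eq_iff dual_scl_def)
  then have "mat_star (dual_star V) (map_mat (dual_scl (complex_of_real r)) f) = map_mat (dual_scl (complex_of_real r)) f"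
    using dual_posD(2)[OF f] by (intro eq_matI) (auto simp: mat_star_def)
  then show ?thesis
    using f r dual_posD(1)[OF f] by (auto simp: dual_pos_def pairing_map_scl map_scl_dual_mat less_eq_complex_def)
qed

text \<open>When \<open>s = 0\<close> there is nothing to divide by, but then \<open>f = 0\<close> because the norm is definite.\<close>

lemma dual_pos_normalize:
  assumes n: "1 \<le> n" and f: "f \<in> dual_pos V n" and s: "dual_norm V n f \<le> s"
  obtains p where "p \<in> Q_set V n" "f = map_mat (dual_scl (complex_of_real s)) p"
proof (cases "s = 0")
  case True
  have f0: "f = 0\<^sub>m n n"
    using dual_norm_eq_0[OF n dual_posD(1)[OF f]] s True by simp
  moreover have "f = map_mat (dual_scl (complex_of_real s)) f"
    unfolding f0 by (rule eq_matI) auto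
  moreover have "f \<in> Q_set V n" using f s True by (simp add: Q_set_def)
  ultimately show thesis using that by blast
next
  case False
  have "0 \<le> dual_norm V n f" using dual_norm_nonneg[OF n dual_posD(1)[OF f]] .
  then have s0: "0 < s" using s False by simp
  let ?p = "map_mat (dual_scl (complex_of_real (1 / s))) f"
  have "?p \<in> dual_pos V n" using s0 by (intro dual_pos_scl n f) auto
  moreover have "dual_norm V n ?p \<le> 1"
    using dual_norm_scl[OF n dual_posD(1)[OF f], of "1 / s"] s s0 by simp
  moreover have "f = map_mat (dual_scl (complex_of_real s)) ?p"
    using s0 by (intro eq_matI) (auto simp: fun_eq_iff)
  ultimately show thesis using that by (simp add: Q_set_def)
qed

text \<open>The functional \<open>\<Oplus> \<gamma>\<^sub>j\<^sup>*g\<gamma>\<^sub>j\<close> sees only the diagonal blocks \<open>v\<^sub>j\<close> of \<open>v\<close>, and on them it is \<open>g\<close>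
  evaluated at the sum of the compressions of the \<open>v\<^sub>j\<close> by \<open>\<gamma>\<^sub>j\<^sup>T\<close>. That sum is a single compression
  of \<open>w = \<Oplus> v\<^sub>j\<close> by the column \<open>\<Delta>\<close> of the \<open>\<gamma>\<^sub>j\<^sup>T\<close>. The column enters through the length of its values
  only, since this is what decides whether it is a contraction. The list is nonempty because
  matrices of size 0 carry no norm.\<close>

lemma pairing_diag_block_mat:
  assumes n: "1 \<le> n" and g: "g \<in> dual_mat V n n" and ne: "js \<noteq> []"
    and \<gamma>: "\<And>j. j \<in> set js \<Longrightarrow> \<gamma> j \<in> carrier_mat n (\<nu> j) \<and> 1 \<le> \<nu> j"
    and v: "v \<in> carrier_mat (\<Sum>j\<leftarrow>js. \<nu> j) (\<Sum>j\<leftarrow>js. \<nu> j)"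
  shows "\<exists>p w \<Delta>. 1 \<le> p \<and> w \<in> carrier_mat p p \<and> \<Delta> \<in> carrier_mat p n \<and>
    mnorm V p w \<le> mnorm V (\<Sum>j\<leftarrow>js. \<nu> j) v \<and>
    pairing (diag_block_mat (map (\<lambda>j. bimod_mult dual_scl (mat_adjoint (\<gamma> j)) g (\<gamma> j)) js)) v =
      pairing g (bimod_mult (scl V) (mat_adjoint \<Delta>) w \<Delta>) \<and>
    (\<forall>x\<in>carrier_vec n. (cvec_norm (\<Delta> *\<^sub>v x))\<^sup>2 = (\<Sum>j\<leftarrow>js. (cvec_norm (transpose_mat (\<gamma> j) *\<^sub>v x))\<^sup>2))"
  using ne \<gamma> v
proof (induction js arbitrary: v rule: list_nonempty_induct)
  case (single j)
  then have \<gamma>j: "\<gamma> j \<in> carrier_mat n (\<nu> j)" "1 \<le> \<nu> j"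
    and v: "v \<in> carrier_mat (\<nu> j) (\<nu> j)" by auto
  have "pairing (bimod_mult dual_scl (mat_adjoint (\<gamma> j)) g (\<gamma> j)) v =
      pairing g (bimod_mult (scl V) (mat_adjoint (transpose_mat (\<gamma> j))) v (transpose_mat (\<gamma> j)))"
    by (rule pairing_compress[OF g \<gamma>j(1) v])
  moreover have "transpose_mat (\<gamma> j) \<in> carrier_mat (\<nu> j) n"
    using \<gamma>j(1) by (rule iffD2[OF transpose_carrier_mat])
  ultimately show ?case
    using \<gamma>j(2) v unfolding list.map diag_block_mat_singleton sum_list.Cons sum_list.Nil add_0_right
    by (intro exI[of _ "\<nu> j"] exI[of _ v] exI[of _ "transpose_mat (\<gamma> j)"] conjI ballI) simp_all
next
  case (cons j js)
  interpret vector_space "scl V" by (rule vector_space)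
  let ?F = "\<lambda>j. bimod_mult dual_scl (mat_adjoint (\<gamma> j)) g (\<gamma> j)"
  let ?k = "\<nu> j" and ?N = "\<Sum>j\<leftarrow>js. \<nu> j"
  have \<gamma>j: "\<gamma> j \<in> carrier_mat n ?k" "1 \<le> ?k" using cons.prems by auto
  have F: "?F j \<in> carrier_mat ?k ?k" using \<gamma>j by (intro bimod_mult_carrier mat_adjoint_carrier)
  define D where "D = diag_block_mat (map ?F js)"
  have D: "D \<in> carrier_mat ?N ?N"
  proof (rule carrier_matI)
    have "(\<Sum>j\<leftarrow>js. dim_col (\<gamma> j)) = ?N"
      using cons.prems(1) by (intro arg_cong[of _ _ sum_list] map_cong) auto
    then show "dim_row D = ?N" "dim_col D = ?N"
      by (simp_all add: D_def dim_diag_block_mat o_def)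
  qed
  have N: "1 \<le> ?N"
    using cons.hyps(1) cons.prems(1) by (cases js) fastforce+
  have "v \<in> carrier_mat (?k + ?N) (?k + ?N)" using cons.prems(2) by simp
  then obtain v11 v12 v21 v22 where c: "v11 \<in> carrier_mat ?k ?k" "v12 \<in> carrier_mat ?k ?N"
    "v21 \<in> carrier_mat ?N ?k" "v22 \<in> carrier_mat ?N ?N" and veq: "v = four_block_mat v11 v12 v21 v22"
    by (rule four_block_mat_exists)
  obtain p w \<Delta> where p: "1 \<le> p" "w \<in> carrier_mat p p" "\<Delta> \<in> carrier_mat p n"
    and w: "mnorm V p w \<le> mnorm V ?N v22"
    and eq: "pairing D v22 = pairing g (bimod_mult (scl V) (mat_adjoint \<Delta>) w \<Delta>)"
    and nrm: "\<forall>x\<in>carrier_vec n. (cvec_norm (\<Delta> *\<^sub>v x))\<^sup>2 = (\<Sum>j\<leftarrow>js. (cvec_norm (transpose_mat (\<gamma> j) *\<^sub>v x))\<^sup>2)"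
    using cons.IH[OF _ c(4)] cons.prems(1) unfolding D_def by (auto simp del: dual_scl_apply)
  have \<gamma>t: "transpose_mat (\<gamma> j) \<in> carrier_mat ?k n" using \<gamma>j by simp
  let ?\<Delta> = "transpose_mat (\<gamma> j) @\<^sub>r \<Delta>" and ?w = "mat_direct_sum v11 w"
  have b: "bimod_mult (scl V) (mat_adjoint (transpose_mat (\<gamma> j))) v11 (transpose_mat (\<gamma> j)) \<in> carrier_mat n n"
    "bimod_mult (scl V) (mat_adjoint \<Delta>) w \<Delta> \<in> carrier_mat n n"
    using p \<gamma>t mat_adjoint_carrier[OF \<gamma>t] by (auto intro!: bimod_mult_carrier)
  have F11: "pairing (?F j) v11 =
      pairing g (bimod_mult (scl V) (mat_adjoint (transpose_mat (\<gamma> j))) v11 (transpose_mat (\<gamma> j)))"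
    by (rule pairing_compress[OF g \<gamma>j(1) c(1)])
  have "diag_block_mat (map ?F (j # js)) = four_block_mat (?F j) (0\<^sub>m ?k ?N) (0\<^sub>m ?N ?k) D"
    using D \<gamma>j(1) by (simp add: D_def Let_def del: dual_scl_apply)
  then have "pairing (diag_block_mat (map ?F (j # js))) v = pairing (?F j) v11 + pairing D v22"
    unfolding veq using pairing_four_block[OF F zero_carrier_mat zero_carrier_mat D c] by simp
  also have "\<dots> = pairing g (bimod_mult (scl V) (mat_adjoint ?\<Delta>) ?w ?\<Delta>)"
    unfolding bimod_mult_append_rows[where sc = "scl V", OF c(1) p(2) \<gamma>t p(3) scale_zero_right] pairing_add[OF g b] F11 eq ..
  finally have 1: "pairing (diag_block_mat (map ?F (j # js))) v = pairing g (bimod_mult (scl V) (mat_adjoint ?\<Delta>) ?w ?\<Delta>)" .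
  have 2: "mnorm V (?k + p) ?w \<le> mnorm V (?k + ?N) v"
    unfolding mnorm_direct_sum[OF \<gamma>j(2) p(1) c(1) p(2)]
    using w mnorm_diag_blocks[OF \<gamma>j(2) N c] unfolding veq by simp
  have 3: "(cvec_norm (?\<Delta> *\<^sub>v x))\<^sup>2 = (\<Sum>j\<leftarrow>j # js. (cvec_norm (transpose_mat (\<gamma> j) *\<^sub>v x))\<^sup>2)"
    if "x \<in> carrier_vec n" for x
    using nrm that by (simp add: mat_mult_append[OF \<gamma>t p(3) that] cvec_norm_append)
  show ?case
    by (intro exI[of _ "?k + p"] exI[of _ ?w] exI[of _ ?\<Delta>] conjI ballI)
       (use 1 2 3 p c \<gamma>j in \<open>simp_all del: diag_block_mat.simps dual_scl_apply add: carrier_append_rows[OF \<gamma>t p(3)]\<close>)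
qed

lemma dual_pos_diag_block_mat:
  assumes n: "1 \<le> n" and g: "g \<in> dual_pos V n" and ne: "js \<noteq> []"
    and \<gamma>: "\<And>j. j \<in> set js \<Longrightarrow> \<gamma> j \<in> carrier_mat n (\<nu> j) \<and> 1 \<le> \<nu> j"
  shows "diag_block_mat (map (\<lambda>j. bimod_mult dual_scl (mat_adjoint (\<gamma> j)) g (\<gamma> j)) js)
    \<in> dual_pos V (\<Sum>j\<leftarrow>js. \<nu> j)"
  using ne \<gamma>
proof (induction js rule: list_nonempty_induct)
  case (single j)
  then show ?case using dual_pos_bimod_mult[OF n _ g, of "\<nu> j" "\<gamma> j"] by (simp del: diag_block_mat.simps dual_scl_apply)
next
  case (cons j js)
  have "1 \<le> (\<Sum>j\<leftarrow>js. \<nu> j)"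
    using cons.hyps(1) cons.prems by (cases js) fastforce+
  moreover have "bimod_mult dual_scl (mat_adjoint (\<gamma> j)) g (\<gamma> j) \<in> dual_pos V (\<nu> j)"
    using cons.prems by (intro dual_pos_bimod_mult[OF n _ g]) auto
  moreover have "diag_block_mat (map (\<lambda>j. bimod_mult dual_scl (mat_adjoint (\<gamma> j)) g (\<gamma> j)) js)
      \<in> dual_pos V (\<Sum>j\<leftarrow>js. \<nu> j)"
    using cons.prems by (intro cons.IH) auto
  ultimately show ?case
    using cons.prems unfolding list.map diag_block_mat.simps Let_def mat_direct_sum_def[symmetric] sum_list.Cons
    by (intro dual_pos_direct_sum) auto
qed

lemma Q_set_diag_block_mat:
  assumes n: "1 \<le> n" and g: "g \<in> Q_set V n" and ne: "js \<noteq> []"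
    and \<gamma>: "\<And>j. j \<in> set js \<Longrightarrow> \<gamma> j \<in> carrier_mat n (\<nu> j) \<and> 1 \<le> \<nu> j"
    and le: "\<And>x. x \<in> carrier_vec n \<Longrightarrow>
      (\<Sum>j\<leftarrow>js. (cvec_norm (transpose_mat (\<gamma> j) *\<^sub>v x))\<^sup>2) \<le> (cvec_norm x)\<^sup>2"
  shows "diag_block_mat (map (\<lambda>j. bimod_mult dual_scl (mat_adjoint (\<gamma> j)) g (\<gamma> j)) js)
    \<in> Q_set V (\<Sum>j\<leftarrow>js. \<nu> j)" (is "?D \<in> Q_set V ?N")
proof -
  have gp: "g \<in> dual_pos V n" and g1: "dual_norm V n g \<le> 1" using g by (auto simp: Q_set_def)
  have N: "1 \<le> ?N" using ne \<gamma> by (cases js) fastforce+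
  have "dual_norm V ?N ?D \<le> 1"
  proof (rule dual_norm_least[OF N])
    fix v assume v: "v \<in> carrier_mat ?N ?N" "mnorm V ?N v \<le> 1"
    obtain p w \<Delta> where p: "1 \<le> p" "w \<in> carrier_mat p p" "\<Delta> \<in> carrier_mat p n"
      and w: "mnorm V p w \<le> mnorm V ?N v"
      and eq: "pairing ?D v = pairing g (bimod_mult (scl V) (mat_adjoint \<Delta>) w \<Delta>)"
      and nrm: "\<forall>x\<in>carrier_vec n. (cvec_norm (\<Delta> *\<^sub>v x))\<^sup>2 = (\<Sum>j\<leftarrow>js. (cvec_norm (transpose_mat (\<gamma> j) *\<^sub>v x))\<^sup>2)"
      using pairing_diag_block_mat[OF n dual_posD(1)[OF gp] ne \<gamma> v(1)] by blast
    have "contraction \<Delta>"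
      by (rule contractionI_sq) (use nrm le p in auto)
    then have "mnorm V n (bimod_mult (scl V) (mat_adjoint \<Delta>) w \<Delta>) \<le> mnorm V p w"
      using n p by (intro mnorm_bimod_contraction contraction_adjoint mat_adjoint_carrier)
    moreover have "bimod_mult (scl V) (mat_adjoint \<Delta>) w \<Delta> \<in> carrier_mat n n"
      using p by (intro bimod_mult_carrier mat_adjoint_carrier)
    ultimately have "cmod (pairing ?D v) \<le> dual_norm V n g"
      unfolding eq using w v by (intro dual_norm_upper n dual_posD(1)[OF gp]) auto
    then show "cmod (pairing ?D v) \<le> 1" using g1 by simp
  qed
  then show ?thesis
    using dual_pos_diag_block_mat[OF n gp ne \<gamma>] by (simp add: Q_set_def)
qed

end

text \<open>With \<open>y\<close> the entrywise conjugate of \<open>x\<close>, one has \<open>\<parallel>\<gamma>\<^sup>T x\<parallel> = \<parallel>\<gamma>\<^sup>*y\<parallel>\<close> and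
  \<open>\<parallel>\<gamma>\<^sup>*y\<parallel>\<^sup>2 = \<langle>\<gamma>\<gamma>\<^sup>*y, y\<rangle>\<close>, so a bound on \<open>\<Sum>\<gamma>\<^sub>i\<gamma>\<^sub>i\<^sup>*\<close> controls the transposes.\<close>

lemma sum_cvec_norm_transpose_le:
  fixes \<gamma> :: "'i \<Rightarrow> complex mat"
  assumes fin: "finite I" and \<gamma>: "\<And>i. i \<in> I \<Longrightarrow> \<gamma> i \<in> carrier_mat n (\<nu> i)"
    and le: "mat_le n (mat n n (\<lambda>ij. \<Sum>i\<in>I. (\<gamma> i * mat_adjoint (\<gamma> i)) $$ ij)) (1\<^sub>m n)" (is "mat_le n ?M _")
    and x: "x \<in> carrier_vec n"
  shows "(\<Sum>i\<in>I. (cvec_norm (transpose_mat (\<gamma> i) *\<^sub>v x))\<^sup>2) \<le> (cvec_norm x)\<^sup>2"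
proof -
  define y where "y = conjugate x"
  have y: "y \<in> carrier_vec n" using x by (simp add: y_def)
  have gram: "((\<gamma> i * mat_adjoint (\<gamma> i)) *\<^sub>v y) \<bullet>c y = complex_of_real ((cvec_norm (transpose_mat (\<gamma> i) *\<^sub>v x))\<^sup>2)"
    if i: "i \<in> I" for i
  proof -
    let ?z = "mat_adjoint (\<gamma> i) *\<^sub>v y"
    have a: "mat_adjoint (\<gamma> i) \<in> carrier_mat (\<nu> i) n" using \<gamma>[OF i] by simp
    have z: "?z \<in> carrier_vec (\<nu> i)" using a y by (rule mult_mat_vec_carrier)
    have "((\<gamma> i * mat_adjoint (\<gamma> i)) *\<^sub>v y) \<bullet>c y = (\<gamma> i *\<^sub>v ?z) \<bullet>c y"
      by (simp only: assoc_mult_mat_vec[OF \<gamma>[OF i] a y])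
    also have "\<dots> = ?z \<bullet>c ?z"
      by (rule inner_mult_adjoint[OF \<gamma>[OF i] z y])
    also have "\<dots> = complex_of_real ((cvec_norm ?z)\<^sup>2)"
      by (rule inner_self_eq_cvec_norm)
    also have "?z = conjugate (transpose_mat (\<gamma> i) *\<^sub>v x)"
      using \<gamma>[OF i] x by (intro eq_vecI) (auto simp: index_mult_vec y_def simp del: index_mult_mat_vec)
    also have "(cvec_norm (conjugate (transpose_mat (\<gamma> i) *\<^sub>v x)))\<^sup>2 = (cvec_norm (transpose_mat (\<gamma> i) *\<^sub>v x))\<^sup>2"
      by (simp add: cvec_norm_sq del: index_mult_mat_vec)
    finally show ?thesis .
  qed
  have P: "\<gamma> i * mat_adjoint (\<gamma> i) \<in> carrier_mat n n" if "i \<in> I" for i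
    using mult_carrier_mat[OF \<gamma>[OF that] mat_adjoint_carrier[OF \<gamma>[OF that]]] .
  have quad: "(A *\<^sub>v y) \<bullet>c y = (\<Sum>a<n. \<Sum>b<n. A $$ (a,b) * y $ b * cnj (y $ a))"
    if "A \<in> carrier_mat n n" for A
    using that y by (simp add: scalar_prod_def lessThan_atLeast0 sum_distrib_right)
  have "(?M *\<^sub>v y) \<bullet>c y = (\<Sum>a<n. \<Sum>b<n. \<Sum>i\<in>I. (\<gamma> i * mat_adjoint (\<gamma> i)) $$ (a,b) * y $ b * cnj (y $ a))"
    by (subst quad) (auto simp: sum_distrib_right intro!: sum.cong)
  also have "\<dots> = (\<Sum>a<n. \<Sum>i\<in>I. \<Sum>b<n. (\<gamma> i * mat_adjoint (\<gamma> i)) $$ (a,b) * y $ b * cnj (y $ a))"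
    by (rule sum.cong[OF refl], rule sum.swap)
  also have "\<dots> = (\<Sum>i\<in>I. \<Sum>a<n. \<Sum>b<n. (\<gamma> i * mat_adjoint (\<gamma> i)) $$ (a,b) * y $ b * cnj (y $ a))"
    by (rule sum.swap)
  also have "\<dots> = (\<Sum>i\<in>I. ((\<gamma> i * mat_adjoint (\<gamma> i)) *\<^sub>v y) \<bullet>c y)"
    by (intro sum.cong refl quad[symmetric] P)
  also have "\<dots> = complex_of_real (\<Sum>i\<in>I. (cvec_norm (transpose_mat (\<gamma> i) *\<^sub>v x))\<^sup>2)"
    by (simp only: gram of_real_sum cong: sum.cong)
  finally have M: "(?M *\<^sub>v y) \<bullet>c y = complex_of_real (\<Sum>i\<in>I. (cvec_norm (transpose_mat (\<gamma> i) *\<^sub>v x))\<^sup>2)" .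
  have "(1\<^sub>m n *\<^sub>v y) \<bullet>c y = complex_of_real ((cvec_norm x)\<^sup>2)"
    unfolding one_mult_mat_vec[OF y] inner_self_eq_cvec_norm by (simp add: cvec_norm_sq y_def)
  moreover have "((1\<^sub>m n - ?M) *\<^sub>v y) \<bullet>c y = (1\<^sub>m n *\<^sub>v y) \<bullet>c y - (?M *\<^sub>v y) \<bullet>c y"
    by (subst (1 2 3) quad) (auto simp: sum_subtractf[symmetric] left_diff_distrib intro!: sum.cong)
  moreover have "0 \<le> ((1\<^sub>m n - ?M) *\<^sub>v y) \<bullet>c y"
    using le y by (auto simp: mat_le_def)
  ultimately have "0 \<le> complex_of_real ((cvec_norm x)\<^sup>2 - (\<Sum>i\<in>I. (cvec_norm (transpose_mat (\<gamma> i) *\<^sub>v x))\<^sup>2))"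
    by (simp only: M of_real_diff)
  then show ?thesis by (simp add: less_eq_complex_def)
qed

section \<open>Block decompositions of a positive functional\<close>

lemma transpose_mat_diag [simp]: "transpose_mat (mat_diag n d) = mat_diag n d"
  by (rule eq_matI) (auto simp: mat_diag_def)

lemma contraction_mat_diag:
  assumes d: "\<And>i. i < n \<Longrightarrow> cmod (d i) \<le> 1"
  shows "contraction (mat_diag n d)"
proof (rule contractionI_sq)
  fix x :: "complex vec" assume "x \<in> carrier_vec (dim_col (mat_diag n d))"
  then have x: "dim_vec x = n" by (simp add: mat_diag_def)
  have dim: "dim_row (mat_diag n d) = n" "dim_col (mat_diag n d) = n" by (auto simp: mat_diag_def)
  have y: "(mat_diag n d *\<^sub>v x) $ i = d i * x $ i" if i: "i < n" for i
  proof -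
    have "(mat_diag n d *\<^sub>v x) $ i = (\<Sum>k<n. mat_diag n d $$ (i,k) * x $ k)"
      using i x by (subst index_mult_vec) (auto simp: dim)
    also have "\<dots> = (\<Sum>k<n. if i = k then d i * x $ k else 0)"
      by (rule sum.cong) (use i in \<open>auto simp: mat_diag_def\<close>)
    finally show ?thesis using i by simp
  qed
  have "(cvec_norm (mat_diag n d *\<^sub>v x))\<^sup>2 = (\<Sum>i<n. (cmod (d i * x $ i))\<^sup>2)"
    unfolding cvec_norm_sq by (rule sum.cong) (auto simp: y dim simp del: index_mult_mat_vec)
  also have "\<dots> \<le> (\<Sum>i<n. (cmod (x $ i))\<^sup>2)"
    by (intro sum_mono power_mono) (auto simp: norm_mult d intro!: mult_left_le_one_le)
  finally show "(cvec_norm (mat_diag n d *\<^sub>v x))\<^sup>2 \<le> (cvec_norm x)\<^sup>2"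
    by (simp add: cvec_norm_sq x)
qed

lemma bimod_mult_mat_diag:
  assumes v: "v \<in> carrier_mat n n" and sc: "\<And>v. sc 0 v = 0" and ij: "i < n" "j < n"
  shows "bimod_mult sc (mat_adjoint (mat_diag n d)) v (mat_diag n d) $$ (i,j) =
    sc (cnj (d i) * d j) (v $$ (i,j))"
proof -
  have "bimod_mult sc (mat_adjoint (mat_diag n d)) v (mat_diag n d) $$ (i,j) =
      (\<Sum>k<n. \<Sum>l<n. if k = i then if l = j then sc (cnj (d i) * d j) (v $$ (i,j)) else 0 else 0)"
    using v ij by (simp add: index_bimod_mult mat_diag_def) (intro sum.cong refl; auto simp: sc)
  then show ?thesis using ij by (simp add: sum_if_const)
qed

text \<open>The transpose of this matrix maps \<open>(x, y)\<close> to \<open>(x + sy)/\<surd>2\<close>. For \<open>s = 1\<close> and \<open>s = -1\<close> the two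
  matrices side by side form the unitary that diagonalizes the block flip.\<close>

definition fold_mat :: "nat \<Rightarrow> complex \<Rightarrow> complex mat" where
  "fold_mat n s = mat (n + n) n (\<lambda>(k,i).
     if k = i then complex_of_real (1 / sqrt 2) else if k = n + i then s * complex_of_real (1 / sqrt 2) else 0)"

lemma fold_mat_carrier [simp]: "fold_mat n s \<in> carrier_mat (n + n) n"
  by (simp add: fold_mat_def)

lemma dim_fold_mat [simp]: "dim_row (fold_mat n s) = n + n" "dim_col (fold_mat n s) = n"
  by (simp_all add: fold_mat_def)

lemma index_fold_mat:
  "k < n \<Longrightarrow> i < n \<Longrightarrow> fold_mat n s $$ (k,i) = (if k = i then complex_of_real (1 / sqrt 2) else 0)"
  "k < n \<Longrightarrow> i < n \<Longrightarrow> fold_mat n s $$ (n + k,i) = (if k = i then s * complex_of_real (1 / sqrt 2) else 0)"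
  by (auto simp: fold_mat_def)

lemma cvec_norm_fold_mat:
  assumes x: "x \<in> carrier_vec (n + n)"
  shows "(cvec_norm (transpose_mat (fold_mat n 1) *\<^sub>v x))\<^sup>2 +
    (cvec_norm (transpose_mat (fold_mat n (-1)) *\<^sub>v x))\<^sup>2 = (cvec_norm x)\<^sup>2"
proof -
  have y: "(transpose_mat (fold_mat n s) *\<^sub>v x) $ i = complex_of_real (1 / sqrt 2) * (x $ i + s * x $ (n + i))"
    if i: "i < n" for i s
  proof -
    have "(transpose_mat (fold_mat n s) *\<^sub>v x) $ i = (\<Sum>k<n + n. fold_mat n s $$ (k,i) * x $ k)"
      using i x by (subst index_mult_vec) auto
    also have "\<dots> = (\<Sum>k<n. if k = i then complex_of_real (1 / sqrt 2) * x $ k else 0) +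
        (\<Sum>k<n. if k = i then s * complex_of_real (1 / sqrt 2) * x $ (n + k) else 0)"
      unfolding sum_lessThan_add
      by (intro arg_cong2[of _ _ _ _ "(+)"] sum.cong refl) (use i in \<open>auto simp: index_fold_mat\<close>)
    finally show ?thesis using i by (simp add: algebra_simps)
  qed
  have N: "(cvec_norm (transpose_mat (fold_mat n s) *\<^sub>v x))\<^sup>2 = (\<Sum>i<n. (cmod (x $ i + s * x $ (n + i)))\<^sup>2 / 2)" for s
    unfolding cvec_norm_sq
    by (rule sum.cong) (auto simp: y norm_mult power_mult_distrib norm_divide power_divide simp del: index_mult_mat_vec)
  have parallelogram: "(cmod (a + b))\<^sup>2 / 2 + (cmod (a - b))\<^sup>2 / 2 = (cmod a)\<^sup>2 + (cmod b)\<^sup>2" for a b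
    unfolding cmod_power2 by (simp add: power2_eq_square field_simps)
  have "(cvec_norm (transpose_mat (fold_mat n 1) *\<^sub>v x))\<^sup>2 +
      (cvec_norm (transpose_mat (fold_mat n (-1)) *\<^sub>v x))\<^sup>2 =
      (\<Sum>i<n. (cmod (x $ i + x $ (n + i)))\<^sup>2 / 2 + (cmod (x $ i - x $ (n + i)))\<^sup>2 / 2)"
    by (simp add: N sum.distrib)
  also have "\<dots> = (\<Sum>i<n. (cmod (x $ i))\<^sup>2 + (cmod (x $ (n + i)))\<^sup>2)"
    by (simp only: parallelogram)
  also have "\<dots> = (cvec_norm x)\<^sup>2"
    using x by (simp add: cvec_norm_sq sum_lessThan_add sum.distrib)
  finally show ?thesis .
qed

lemma bimod_mult_fold_mat:
  assumes c: "a \<in> carrier_mat n n" "b \<in> carrier_mat n n" "c \<in> carrier_mat n n" "d \<in> carrier_mat n n"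
    and s: "cnj s * s = 1" and ij: "i < n" "j < n"
  shows "bimod_mult dual_scl (mat_adjoint (fold_mat n s)) (four_block_mat a b c d) (fold_mat n s) $$ (i,j) =
    dual_scl (1 / 2) (a $$ (i,j) + dual_scl s (b $$ (i,j)) + dual_scl (cnj s) (c $$ (i,j)) + d $$ (i,j))"
proof -
  let ?f = "four_block_mat a b c d" and ?r = "complex_of_real (1 / sqrt 2)"
  have r: "?r * ?r = 1 / 2"
    unfolding of_real_mult[symmetric] by simp
  have f: "?f \<in> carrier_mat (n + n) (n + n)" using c by simp
  have fs: "?f $$ (i,j) = a $$ (i,j)" "?f $$ (i,n + j) = b $$ (i,j)" "?f $$ (n + i,j) = c $$ (i,j)"
    "?f $$ (n + i,n + j) = d $$ (i,j)"
    using c ij by auto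
  have "bimod_mult dual_scl (mat_adjoint (fold_mat n s)) ?f (fold_mat n s) $$ (i,j) =
      (\<Sum>k<n + n. \<Sum>l<n + n. dual_scl (cnj (fold_mat n s $$ (k,i)) * fold_mat n s $$ (l,j)) (?f $$ (k,l)))"
    using ij carrier_matD[OF f] by (subst index_bimod_mult) (simp_all only: dim_mat_adjoint dim_fold_mat,
        auto intro!: sum.cong)
  also have "\<dots> = (\<Sum>k<n. \<Sum>l<n. if k = i then if l = j then dual_scl (?r * ?r) (?f $$ (i,j)) else 0 else 0) +
      (\<Sum>k<n. \<Sum>l<n. if k = i then if l = j then dual_scl (cnj s * ?r * ?r) (?f $$ (n + i,j)) else 0 else 0) +
      ((\<Sum>k<n. \<Sum>l<n. if k = i then if l = j then dual_scl (?r * (s * ?r)) (?f $$ (i,n + j)) else 0 else 0) +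
      (\<Sum>k<n. \<Sum>l<n. if k = i then if l = j then dual_scl (cnj s * ?r * (s * ?r)) (?f $$ (n + i,n + j)) else 0 else 0))"
    unfolding sum_lessThan_add sum.distrib
    by (intro arg_cong2[of _ _ _ _ "(+)"] sum.cong refl) (use ij in \<open>auto simp: index_fold_mat dual_scl_def\<close>)
  also have "\<dots> = dual_scl (?r * ?r) (a $$ (i,j)) + dual_scl (cnj s * ?r * ?r) (c $$ (i,j)) +
      (dual_scl (?r * (s * ?r)) (b $$ (i,j)) + dual_scl (cnj s * ?r * (s * ?r)) (d $$ (i,j)))"
    using ij by (simp only: sum_if_const fs) simp
  also have "\<dots> = dual_scl (1 / 2) (a $$ (i,j) + dual_scl s (b $$ (i,j)) + dual_scl (cnj s) (c $$ (i,j)) + d $$ (i,j))"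
  proof -
    have "?r * (s * ?r) = s * (?r * ?r)" "cnj s * ?r * ?r = cnj s * (?r * ?r)"
      "cnj s * ?r * (s * ?r) = (cnj s * s) * (?r * ?r)"
      by (simp_all only: mult_ac)
    note 1 = this[unfolded r s]
    show ?thesis unfolding 1 r by (rule ext) (simp add: algebra_simps)
  qed
  finally show ?thesis .
qed

text \<open>A phase on the off-diagonal blocks comes from conjugation by a diagonal unitary.\<close>

lemma four_block_rotate:
  fixes \<theta> :: real and a b c d :: "('v \<Rightarrow> complex) mat"
  assumes c: "a \<in> carrier_mat m m" "b \<in> carrier_mat m n" "c \<in> carrier_mat n m" "d \<in> carrier_mat n n"
  shows "four_block_mat a (map_mat (dual_scl (exp (\<i> * complex_of_real \<theta>))) b)
      (map_mat (dual_scl (exp (- \<i> * complex_of_real \<theta>))) c) d =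
    bimod_mult dual_scl (mat_adjoint (mat_diag (m + n) (\<lambda>i. if i < m then 1 else exp (\<i> * complex_of_real \<theta>))))
      (four_block_mat a b c d) (mat_diag (m + n) (\<lambda>i. if i < m then 1 else exp (\<i> * complex_of_real \<theta>)))"
    (is "?L = ?R")
proof (rule eq_matI)
  show "dim_row ?L = dim_row ?R" "dim_col ?L = dim_col ?R" using c by (auto simp: mat_diag_def)
  fix i j assume "i < dim_row ?R" "j < dim_col ?R"
  then have ij: "i < m + n" "j < m + n" by (auto simp: mat_diag_def)
  let ?e = "exp (\<i> * complex_of_real \<theta>)"
  have e: "cnj ?e = exp (- \<i> * complex_of_real \<theta>)" by (simp add: cis_conv_exp[symmetric] cis_cnj) (simp add: cis_conv_exp)
  have e1: "cnj ?e * ?e = 1" unfolding e by (simp add: exp_minus)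
  have f: "four_block_mat a b c d \<in> carrier_mat (m + n) (m + n)" using c by simp
  have s0: "dual_scl 0 \<phi> = 0" and s1: "dual_scl 1 \<phi> = \<phi>" for \<phi> :: "'v \<Rightarrow> complex"
    by (auto simp: fun_eq_iff)
  have "?R $$ (i,j) = dual_scl (cnj (if i < m then 1 else ?e) * (if j < m then 1 else ?e)) (four_block_mat a b c d $$ (i,j))"
    by (rule bimod_mult_mat_diag[where sc = dual_scl, OF f s0 ij])
  also have "\<dots> = ?L $$ (i,j)"
    using ij c e1 e by (auto simp: s1 simp del: dual_scl_apply)
  finally show "?L $$ (i,j) = ?R $$ (i,j)" by simp
qed

context cstar_ordered_operator_space begin

text \<open>The off-diagonal blocks \<open>b\<close> and \<open>c\<close> do not meet \<open>v \<oplus> w\<close>, and \<open>v \<oplus> w\<close> is in the unit ball whenever \<open>v\<close> and \<open>w\<close>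
  are: the norm of a direct sum is a maximum, and maxima dualize to sums.\<close>

lemma dual_norm_diag_blocks:
  assumes n: "1 \<le> m" "1 \<le> n"
    and c: "a \<in> dual_mat V m m" "b \<in> dual_mat V m n" "c \<in> dual_mat V n m" "d \<in> dual_mat V n n"
  shows "dual_norm V m a + dual_norm V n d \<le> dual_norm V (m + n) (four_block_mat a b c d)"
proof (rule dual_norm_add_le[OF n c(1,4)])
  fix v w assume v: "v \<in> carrier_mat m m" "mnorm V m v \<le> 1" and w: "w \<in> carrier_mat n n" "mnorm V n w \<le> 1"
  have eq: "mat_direct_sum v w = four_block_mat v (0\<^sub>m m n) (0\<^sub>m n m) w"
    using v w by (auto simp: mat_direct_sum_def)
  have "pairing (four_block_mat a b c d) (mat_direct_sum v w) = pairing a v + pairing d w"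
    unfolding eq using pairing_four_block[OF c[THEN dual_mat_carrier] v(1) zero_carrier_mat zero_carrier_mat w(1)]
    by (simp add: pairing_of_zero[OF c(2)] pairing_of_zero[OF c(3)])
  moreover have "mnorm V (m + n) (mat_direct_sum v w) \<le> 1"
    using mnorm_direct_sum[OF n v(1) w(1)] v w by simp
  ultimately show "cmod (pairing a v + pairing d w) \<le> dual_norm V (m + n) (four_block_mat a b c d)"
    using dual_norm_upper[of "m + n" "four_block_mat a b c d" "mat_direct_sum v w"] n v w four_block_dual_mat[OF c]
    by simp
qed

text \<open>Deleting \<open>b\<close> and \<open>c\<close> amounts to deleting the off-diagonal blocks of the argument, which does not
  increase its norm.\<close>

lemma dual_norm_block_diagonal_le:
  assumes n: "1 \<le> m" "1 \<le> n"
    and c: "a \<in> dual_mat V m m" "b \<in> dual_mat V m n" "c \<in> dual_mat V n m" "d \<in> dual_mat V n n"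
  shows "dual_norm V (m + n) (four_block_mat a (0\<^sub>m m n) (0\<^sub>m n m) d) \<le> dual_norm V (m + n) (four_block_mat a b c d)"
proof (rule dual_norm_least)
  show "1 \<le> m + n" using n by simp
  fix v assume v: "v \<in> carrier_mat (m + n) (m + n)" "mnorm V (m + n) v \<le> 1"
  from v(1) obtain v11 v12 v21 v22 where vc: "v11 \<in> carrier_mat m m" "v12 \<in> carrier_mat m n"
    "v21 \<in> carrier_mat n m" "v22 \<in> carrier_mat n n" and veq: "v = four_block_mat v11 v12 v21 v22"
    by (rule four_block_mat_exists)
  have "pairing (four_block_mat a (0\<^sub>m m n) (0\<^sub>m n m) d) v = pairing a v11 + pairing d v22"
    unfolding veq using pairing_four_block[OF c(1)[THEN dual_mat_carrier] zero_carrier_mat zero_carrier_mat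
        c(4)[THEN dual_mat_carrier] vc] by simp
  also have "\<dots> = pairing (four_block_mat a b c d) (four_block_mat v11 (0\<^sub>m m n) (0\<^sub>m n m) v22)"
    using pairing_four_block[OF c[THEN dual_mat_carrier] vc(1) zero_carrier_mat zero_carrier_mat vc(4)]
    by (simp add: pairing_of_zero[OF c(2)] pairing_of_zero[OF c(3)])
  also have "four_block_mat v11 (0\<^sub>m m n) (0\<^sub>m n m) v22 = mat_direct_sum v11 v22"
    using vc by (auto simp: mat_direct_sum_def)
  finally have eq: "pairing (four_block_mat a (0\<^sub>m m n) (0\<^sub>m n m) d) v =
      pairing (four_block_mat a b c d) (mat_direct_sum v11 v22)" .
  have "mnorm V (m + n) (mat_direct_sum v11 v22) \<le> 1"
    using mnorm_direct_sum[OF n vc(1,4)] mnorm_diag_blocks[OF n vc] v(2) unfolding veq by simp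
  then show "cmod (pairing (four_block_mat a (0\<^sub>m m n) (0\<^sub>m n m) d) v) \<le> dual_norm V (m + n) (four_block_mat a b c d)"
    unfolding eq using n vc four_block_dual_mat[OF c] by (intro dual_norm_upper) auto
qed

lemma four_block_rotate_le:
  fixes \<theta> :: real
  assumes n: "1 \<le> m" "1 \<le> n"
    and c: "a \<in> carrier_mat m m" "b \<in> carrier_mat m n" "c \<in> carrier_mat n m" "d \<in> carrier_mat n n"
  defines "g \<equiv> four_block_mat a (map_mat (dual_scl (exp (\<i> * complex_of_real \<theta>))) b)
      (map_mat (dual_scl (exp (- \<i> * complex_of_real \<theta>))) c) d"
  shows "four_block_mat a b c d \<in> dual_pos V (m + n) \<Longrightarrow> g \<in> dual_pos V (m + n)"
    and "four_block_mat a b c d \<in> dual_mat V (m + n) (m + n) \<Longrightarrow>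
      dual_norm V (m + n) g \<le> dual_norm V (m + n) (four_block_mat a b c d)"
proof -
  show "four_block_mat a b c d \<in> dual_pos V (m + n) \<Longrightarrow> g \<in> dual_pos V (m + n)"
    unfolding g_def four_block_rotate[OF c] using n by (intro dual_pos_bimod_mult) auto
  show "four_block_mat a b c d \<in> dual_mat V (m + n) (m + n) \<Longrightarrow>
      dual_norm V (m + n) g \<le> dual_norm V (m + n) (four_block_mat a b c d)"
    unfolding g_def four_block_rotate[OF c] using n
    by (intro dual_norm_bimod_mult_le) (auto intro!: contraction_mat_diag)
qed

text \<open>The off-diagonal part is half the difference of the functional and its rotation by the angle \<open>\<pi>\<close>.\<close>

lemma dual_norm_off_diagonal_le:
  assumes n: "1 \<le> m" "1 \<le> n"
    and c: "a \<in> dual_mat V m m" "b \<in> dual_mat V m n" "c \<in> dual_mat V n m" "d \<in> dual_mat V n n"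
  shows "dual_norm V (m + n) (four_block_mat (0\<^sub>m m m) b c (0\<^sub>m n n)) \<le> dual_norm V (m + n) (four_block_mat a b c d)"
proof (rule dual_norm_least)
  show mn: "1 \<le> m + n" using n by simp
  note cc = c[THEN dual_mat_carrier]
  define g where "g = four_block_mat a (map_mat (dual_scl (exp (\<i> * complex_of_real pi))) b)
      (map_mat (dual_scl (exp (- \<i> * complex_of_real pi))) c) d"
  have g: "g \<in> dual_mat V (m + n) (m + n)"
    unfolding g_def using c by (intro four_block_dual_mat map_scl_dual_mat)
  have gle: "dual_norm V (m + n) g \<le> dual_norm V (m + n) (four_block_mat a b c d)"
    unfolding g_def by (rule four_block_rotate_le(2)[OF n cc four_block_dual_mat[OF c]])
  fix v assume v: "v \<in> carrier_mat (m + n) (m + n)" "mnorm V (m + n) v \<le> 1"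
  from v(1) obtain v11 v12 v21 v22 where vc: "v11 \<in> carrier_mat m m" "v12 \<in> carrier_mat m n"
    "v21 \<in> carrier_mat n m" "v22 \<in> carrier_mat n n" and veq: "v = four_block_mat v11 v12 v21 v22"
    by (rule four_block_mat_exists)
  have e: "exp (\<i> * complex_of_real pi) = -1" "exp (- (\<i> * complex_of_real pi)) = -1"
    by (simp_all add: exp_minus)
  have "pairing g v = pairing a v11 - pairing b v12 - pairing c v21 + pairing d v22"
    unfolding g_def veq
    by (subst pairing_four_block[OF _ _ _ _ vc]) (use cc in \<open>auto simp: pairing_map_scl e simp del: dual_scl_apply\<close>)
  moreover have "pairing (four_block_mat a b c d) v = pairing a v11 + pairing b v12 + pairing c v21 + pairing d v22"
    unfolding veq by (rule pairing_four_block[OF cc vc])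
  moreover have "pairing (four_block_mat (0\<^sub>m m m) b c (0\<^sub>m n n)) v = pairing b v12 + pairing c v21"
    unfolding veq by (subst pairing_four_block[OF _ cc(2,3) _ vc]) auto
  ultimately have "2 * pairing (four_block_mat (0\<^sub>m m m) b c (0\<^sub>m n n)) v =
      pairing (four_block_mat a b c d) v - pairing g v"
    by simp
  then have "2 * cmod (pairing (four_block_mat (0\<^sub>m m m) b c (0\<^sub>m n n)) v) =
      cmod (pairing (four_block_mat a b c d) v - pairing g v)"
    by (metis norm_mult norm_numeral)
  also have "\<dots> \<le> cmod (pairing (four_block_mat a b c d) v) + cmod (pairing g v)"
    by (rule norm_triangle_ineq4)
  also have "\<dots> \<le> dual_norm V (m + n) (four_block_mat a b c d) + dual_norm V (m + n) (four_block_mat a b c d)"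
    using dual_norm_upper[OF mn four_block_dual_mat[OF c] v] dual_norm_upper[OF mn g v] gle by linarith
  finally show "cmod (pairing (four_block_mat (0\<^sub>m m m) b c (0\<^sub>m n n)) v) \<le> dual_norm V (m + n) (four_block_mat a b c d)"
    by simp
qed

text \<open>Write \<open>f\<close> for the functional with blocks \<open>a\<close>, \<open>b\<close>, \<open>c\<close>, \<open>d\<close>. Compressing \<open>f\<close> by the columns
  \<open>(I, \<plusminus>I)/\<surd>2\<close> gives \<open>(a + d \<plusminus> (b + c))/2\<close>, two positive functionals whose difference is \<open>b + c\<close>. Each of them separately has norm at most \<open>\<parallel>f\<parallel>\<close>; the sum of their
  norms satisfies the same bound because the two columns form a unitary, so that testing on \<open>v\<close> and \<open>w\<close>
  means testing \<open>f\<close> on a matrix unitarily equivalent to \<open>v \<oplus> w\<close>.\<close>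

lemma off_diagonal_split:
  assumes n: "1 \<le> n" and f: "four_block_mat a b c d \<in> dual_pos V (n + n)" (is "?f \<in> _")
    and c: "a \<in> carrier_mat n n" "b \<in> carrier_mat n n" "c \<in> carrier_mat n n" "d \<in> carrier_mat n n"
  obtains p q where "p \<in> dual_pos V n" "q \<in> dual_pos V n" "b + c = p - q"
    "dual_norm V n p + dual_norm V n q \<le> dual_norm V (n + n) ?f"
proof
  let ?X = "\<lambda>s. bimod_mult dual_scl (mat_adjoint (fold_mat n s)) ?f (fold_mat n s)"
  let ?T = "\<lambda>s. transpose_mat (fold_mat n s)"
  have fd: "?f \<in> dual_mat V (n + n) (n + n)" by (rule dual_posD(1)[OF f])
  show X: "?X 1 \<in> dual_pos V n" "?X (-1) \<in> dual_pos V n"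
    using n f dual_pos_bimod_mult[of "n + n" n ?f, OF _ _ _ fold_mat_carrier] by auto
  show "b + c = ?X 1 - ?X (-1)"
  proof (rule eq_matI)
    fix i j assume "i < dim_row (?X 1 - ?X (-1))" "j < dim_col (?X 1 - ?X (-1))"
    then have ij: "i < n" "j < n" by (auto simp: fold_mat_def)
    show "(b + c) $$ (i,j) = (?X 1 - ?X (-1)) $$ (i,j)"
    proof
      fix x
      have "(?X 1 - ?X (-1)) $$ (i,j) = ?X 1 $$ (i,j) - ?X (-1) $$ (i,j)"
        using ij by (intro index_minus_mat) auto
      then have "((?X 1 - ?X (-1)) $$ (i,j)) x = (?X 1 $$ (i,j)) x - (?X (-1) $$ (i,j)) x"
        by (simp only: minus_apply)
      also have "\<dots> = (b $$ (i,j)) x + (c $$ (i,j)) x"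
        by (subst (1 2) bimod_mult_fold_mat[OF c _ ij]) (auto simp: algebra_simps)
      finally show "((b + c) $$ (i,j)) x = ((?X 1 - ?X (-1)) $$ (i,j)) x"
        using ij c by simp
    qed
  qed (use c in \<open>auto simp: fold_mat_def\<close>)
  show "dual_norm V n (?X 1) + dual_norm V n (?X (-1)) \<le> dual_norm V (n + n) ?f"
  proof (rule dual_norm_add_le[OF n n X[THEN dual_posD(1)]])
    fix v w assume v: "v \<in> carrier_mat n n" "mnorm V n v \<le> 1" and w: "w \<in> carrier_mat n n" "mnorm V n w \<le> 1"
    let ?v = "bimod_mult (scl V) (mat_adjoint (?T 1)) v (?T 1)"
    let ?w = "bimod_mult (scl V) (mat_adjoint (?T (-1))) w (?T (-1))"
    have T: "?T s \<in> carrier_mat n (n + n)" for s by simp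
    have vw: "?v \<in> carrier_mat (n + n) (n + n)" "?w \<in> carrier_mat (n + n) (n + n)"
      by (rule bimod_mult_carrier[OF mat_adjoint_carrier[OF T] T])+
    have "pairing (?X 1) v + pairing (?X (-1)) w = pairing ?f (?v + ?w)"
      unfolding pairing_compress[OF fd fold_mat_carrier v(1)] pairing_compress[OF fd fold_mat_carrier w(1)]
      by (rule pairing_add[OF fd vw, symmetric])
    moreover have "mnorm V (n + n) (?v + ?w) \<le> max (mnorm V n v) (mnorm V n w)"
      using n by (intro mnorm_compress_add v w T) (auto simp only: cvec_norm_fold_mat)
    ultimately show "cmod (pairing (?X 1) v + pairing (?X (-1)) w) \<le> dual_norm V (n + n) ?f"
      using dual_norm_upper[OF _ fd, of "?v + ?w"] n v w vw by simp
  qed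
qed

text \<open>The weights are \<open>\<parallel>p\<parallel>\<close> and \<open>1 - \<parallel>p\<parallel>\<close>. The second one is only an upper bound for \<open>\<parallel>q\<parallel>\<close>, which
  is all that normalization needs.\<close>

lemma dual_co_Q_setI:
  assumes n: "1 \<le> n" and p: "p \<in> dual_pos V n" and q: "q \<in> dual_pos V n"
    and le: "dual_norm V n p + dual_norm V n q \<le> 1"
  shows "p - q \<in> dual_co n (Q_set V n \<union> uminus ` Q_set V n)"
proof -
  define s where "s = dual_norm V n p"
  have s: "0 \<le> s" "s \<le> 1"
    using le dual_norm_nonneg[OF n dual_posD(1)[OF p]] dual_norm_nonneg[OF n dual_posD(1)[OF q]]
    by (auto simp: s_def)
  obtain p' where p': "p' \<in> Q_set V n" "p = map_mat (dual_scl (complex_of_real s)) p'"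
    using dual_pos_normalize[OF n p] s_def by blast
  obtain q' where q': "q' \<in> Q_set V n" "q = map_mat (dual_scl (complex_of_real (1 - s))) q'"
    using dual_pos_normalize[OF n q, of "1 - s"] le unfolding s_def by auto
  have c: "p' \<in> carrier_mat n n" "q' \<in> carrier_mat n n"
    using p' q' by (auto simp: Q_set_def intro: dual_posD)
  have eq: "p - q = map_mat (dual_scl (complex_of_real s)) p' + map_mat (dual_scl (complex_of_real (1 - s))) (- q')"
    unfolding p'(2) q'(2) using c by (intro eq_matI) (auto simp: fun_eq_iff)
  show ?thesis
    unfolding dual_co_def hull_def
  proof (intro InterI)
    fix T assume "T \<in> {T. dual_convex n T \<and> Q_set V n \<union> uminus ` Q_set V n \<subseteq> T}"
    then have T: "dual_convex n T" "p' \<in> T" "- q' \<in> T" using p' q' by auto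
    then show "p - q \<in> T"
      unfolding eq using s by (auto simp: dual_convex_def simp del: of_real_diff dual_scl_apply)
  qed
qed

end

theorem proposition3p5:
  fixes V :: "'v::ab_group_add matrix_space"
    and m n :: nat
    and f f11 f12 f22 :: "('v \<Rightarrow> complex) mat"
  assumes V: "cstar_ordered_operator_space V"
    and m: "1 \<le> m" and n: "1 \<le> n"
    and f: "f \<in> Q_set V (m + n)"
    and f_blocks: "f = four_block_mat f11 f12 (mat_star (dual_star V) f12) f22"
    and f11: "f11 \<in> dual_pos V m"
    and f22: "f22 \<in> dual_pos V n"
    and f12: "f12 \<in> dual_mat V m n"
  shows
    "(f11 \<in> Q_set V m \<and> f22 \<in> Q_set V n)
     \<and>
     (\<forall>\<theta>::real.
        four_block_mat f11 (map_mat (dual_scl (exp (\<i> * complex_of_real \<theta>))) f12)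
          (map_mat (dual_scl (exp (- \<i> * complex_of_real \<theta>))) (mat_star (dual_star V) f12)) f22
        \<in> Q_set V (m + n))
     \<and>
     (dual_norm V (m + n)
        (four_block_mat (0\<^sub>m m m) f12 (mat_star (dual_star V) f12) (0\<^sub>m n n))
      \<le> dual_norm V (m + n) (four_block_mat f11 f12 (mat_star (dual_star V) f12) f22)
      \<and>
      dual_norm V (m + n) (four_block_mat f11 (0\<^sub>m m n) (0\<^sub>m n m) f22)
      \<le> dual_norm V (m + n) (four_block_mat f11 f12 (mat_star (dual_star V) f12) f22))
     \<and>
     (m = n \<longrightarrow>
        f12 + mat_star (dual_star V) f12 \<in> dual_co n (Q_set V n \<union> uminus ` Q_set V n))
     \<and>
     (\<forall>g \<in> Q_set V n. \<forall>(k::nat) (\<nu> :: nat \<Rightarrow> nat) (\<gamma> :: nat \<Rightarrow> complex mat).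
        1 \<le> k \<longrightarrow>
        (\<forall>i\<in>{1..k}. 1 \<le> \<nu> i \<and> \<gamma> i \<in> carrier_mat n (\<nu> i)) \<longrightarrow>
        mat_le n (mat n n (\<lambda>ij. \<Sum>i=1..k. (\<gamma> i * mat_adjoint (\<gamma> i)) $$ ij)) (1\<^sub>m n) \<longrightarrow>
        diag_block_mat (map (\<lambda>i. bimod_mult dual_scl (mat_adjoint (\<gamma> i)) g (\<gamma> i)) [1..<Suc k])
        \<in> Q_set V (\<Sum>i=1..k. \<nu> i))
     \<and>
     (\<forall>(\<alpha>1::real) (\<alpha>2::real) h11 h22.
        0 \<le> \<alpha>1 \<longrightarrow> \<alpha>1 \<le> 1 \<longrightarrow> 0 \<le> \<alpha>2 \<longrightarrow> \<alpha>2 \<le> 1 \<longrightarrow>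
        h11 \<in> S_set V m \<longrightarrow> h22 \<in> S_set V n \<longrightarrow>
        f11 = map_mat (dual_scl (complex_of_real \<alpha>1)) h11 \<longrightarrow>
        f22 = map_mat (dual_scl (complex_of_real \<alpha>2)) h22 \<longrightarrow>
        \<alpha>1 + \<alpha>2 \<le> 1)"
proof -
  interpret cstar_ordered_operator_space V by (rule V)
  let ?c = "mat_star (dual_star V) f12"
  have mn: "1 \<le> m + n" using m by simp
  have fp: "f \<in> dual_pos V (m + n)" and f1: "dual_norm V (m + n) f \<le> 1"
    using f by (auto simp: Q_set_def)
  note fp' = fp[unfolded f_blocks] and f1' = f1[unfolded f_blocks]
  note a = dual_posD(1)[OF f11] and d = dual_posD(1)[OF f22]
  \<comment> \<open>The adjoint block inherits boundedness from \<open>f\<close>, of which it is a corner.\<close>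
  have c: "?c \<in> dual_mat V n m"
  proof (rule dual_matI)
    show cc: "?c \<in> carrier_mat n m" using dual_mat_carrier[OF f12] by (auto simp: mat_star_def)
    fix i j assume ij: "i < n" "j < m"
    have "f $$ (m + i, j) \<in> banach_dual V"
      by (rule index_dual_mat[OF dual_posD(1)[OF fp]]) (use ij in auto)
    moreover have "f $$ (m + i, j) = ?c $$ (i, j)"
      unfolding f_blocks using ij a[THEN dual_mat_carrier] d[THEN dual_mat_carrier] by simp
    ultimately show "?c $$ (i, j) \<in> banach_dual V" by simp
  qed
  note blocks = a f12 c d
  note carriers = blocks[THEN dual_mat_carrier]
  have add_le: "dual_norm V m f11 + dual_norm V n f22 \<le> 1"
    using dual_norm_diag_blocks[OF m n blocks] f1' by simp
  have "f11 \<in> Q_set V m \<and> f22 \<in> Q_set V n"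
    using add_le dual_norm_nonneg[OF m a] dual_norm_nonneg[OF n d] f11 f22 by (simp add: Q_set_def)
  moreover have "\<forall>\<theta>::real. four_block_mat f11 (map_mat (dual_scl (exp (\<i> * complex_of_real \<theta>))) f12)
      (map_mat (dual_scl (exp (- \<i> * complex_of_real \<theta>))) ?c) f22 \<in> Q_set V (m + n)"
    unfolding Q_set_def
    using four_block_rotate_le[OF m n carriers] fp' f1' dual_posD(1)[OF fp'] by (blast intro: order_trans)
  moreover have "dual_norm V (m + n) (four_block_mat (0\<^sub>m m m) f12 ?c (0\<^sub>m n n))
      \<le> dual_norm V (m + n) (four_block_mat f11 f12 ?c f22)"
    by (rule dual_norm_off_diagonal_le[OF m n blocks])
  moreover have "dual_norm V (m + n) (four_block_mat f11 (0\<^sub>m m n) (0\<^sub>m n m) f22)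
      \<le> dual_norm V (m + n) (four_block_mat f11 f12 ?c f22)"
    by (rule dual_norm_block_diagonal_le[OF m n blocks])
  moreover have "m = n \<longrightarrow> f12 + ?c \<in> dual_co n (Q_set V n \<union> uminus ` Q_set V n)"
  proof
    assume eq: "m = n"
    obtain p q where p: "p \<in> dual_pos V n" "q \<in> dual_pos V n" "f12 + ?c = p - q"
      and le: "dual_norm V n p + dual_norm V n q \<le> dual_norm V (n + n) (four_block_mat f11 f12 ?c f22)"
      using off_diagonal_split[OF n fp'[unfolded eq] carriers[unfolded eq]] by blast
    show "f12 + ?c \<in> dual_co n (Q_set V n \<union> uminus ` Q_set V n)"
      unfolding p(3) using le f1'[unfolded eq] by (intro dual_co_Q_setI n p) simp
  qed
  moreover have "diag_block_mat (map (\<lambda>i. bimod_mult dual_scl (mat_adjoint (\<gamma> i)) g (\<gamma> i)) [1..<Suc k])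
      \<in> Q_set V (\<Sum>i=1..k. \<nu> i)"
    if g: "g \<in> Q_set V n" and k: "1 \<le> k" and \<gamma>: "\<forall>i\<in>{1..k}. 1 \<le> \<nu> i \<and> \<gamma> i \<in> carrier_mat n (\<nu> i)"
      and le: "mat_le n (mat n n (\<lambda>ij. \<Sum>i=1..k. (\<gamma> i * mat_adjoint (\<gamma> i)) $$ ij)) (1\<^sub>m n)"
    for g :: "('v \<Rightarrow> complex) mat" and k :: nat and \<nu> :: "nat \<Rightarrow> nat" and \<gamma> :: "nat \<Rightarrow> complex mat"
  proof -
    have sum: "(\<Sum>i\<leftarrow>[1..<Suc k]. h i) = (\<Sum>i=1..k. h i)" for h :: "nat \<Rightarrow> 'b::comm_monoid_add"
      by (simp only: interv_sum_list_conv_sum_set_nat set_upt atLeastLessThanSuc_atLeastAtMost)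
    show ?thesis
      unfolding sum[symmetric]
    proof (rule Q_set_diag_block_mat[OF n g])
      show "[1..<Suc k] \<noteq> []" using k by simp
      show "\<gamma> j \<in> carrier_mat n (\<nu> j) \<and> 1 \<le> \<nu> j" if "j \<in> set [1..<Suc k]" for j
        using \<gamma> that by auto
      show "(\<Sum>j\<leftarrow>[1..<Suc k]. (cvec_norm (transpose_mat (\<gamma> j) *\<^sub>v x))\<^sup>2) \<le> (cvec_norm x)\<^sup>2"
        if "x \<in> carrier_vec n" for x
        unfolding sum by (rule sum_cvec_norm_transpose_le[OF _ _ le that]) (use \<gamma> in auto)
    qed
  qed
  moreover have "\<alpha>1 + \<alpha>2 \<le> 1"
    if "0 \<le> \<alpha>1" "0 \<le> \<alpha>2" "h11 \<in> S_set V m" "h22 \<in> S_set V n"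
      "f11 = map_mat (dual_scl (complex_of_real \<alpha>1)) h11" "f22 = map_mat (dual_scl (complex_of_real \<alpha>2)) h22"
    for \<alpha>1 \<alpha>2 :: real and h11 h22
  proof -
    have h: "h11 \<in> dual_mat V m m" "h22 \<in> dual_mat V n n"
      and norms: "dual_norm V m h11 = 1" "dual_norm V n h22 = 1"
      using that(3,4) by (auto simp: S_set_def Q_set_def dual_pos_def)
    have "dual_norm V m f11 = \<alpha>1" "dual_norm V n f22 = \<alpha>2"
      unfolding that(5,6) dual_norm_scl[OF m h(1) that(1)] dual_norm_scl[OF n h(2) that(2)] norms by simp_all
    then show ?thesis using add_le by simp
  qed
  ultimately show ?thesis by blast
qed

end
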